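(* Let $n\ge 3$ and let $f:S^{n-1}\to\mathbb{R}$ be a continuous function. Assume that for every great circle $\mathcal{C}\subset S^{n-1}$ the Fourier coefficients of the restriction $f|_{\mathcal{C}}$ corresponding to frequencies $2$ and $3$ vanish, that is, $\widehat{f|_{\mathcal{C}}}(\pm j)=0$ for $j=2,3$. Then there exist a constant $c\in\mathbb{R}$ and a vector $a\in\mathbb{R}^n$ such that $f(x)=c+\langle a,x\rangle$ for all $x\in S^{n-1}$.
   Context: $S^{n-1}$ is the Euclidean unit sphere in $\mathbb{R}^n$. A great circle is $\mathcal{C}=S^{n-1}\cap P$ with $P$ a two-dimensional linear subspace. If $e_1,e_2$ is an orthonormal basis of $P$, the circle is parametrized by $u(\theta)=e_1\cos\theta+e_2\sin\theta$, $\theta\in[0,2\pi]$, and $$\widehat{f|_{\mathcal{C}}}(m)=\frac{1}{2\pi}\int_0^{2\pi}f(u(\theta))e^{-im\theta}\,d\theta,\qquad m\in\mathbb{Z}.$$ The simultaneous vanishing of the coefficients with indices $m$ and $-m$ does not depend on the choice of the orthonormal basis. *)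

theory Defs
  imports "HOL-Analysis.Analysis"
begin

definition great_circle :: "'a::euclidean_space set \<Rightarrow> bool" where
  "great_circle C \<longleftrightarrow> (\<exists>P. subspace P \<and> dim P = 2 \<and> C = sphere 0 1 \<inter> P)"

text \<open>\<open>(e1, e2)\<close> is an orthonormal basis of the plane \<open>P\<close> with \<open>C = sphere 0 1 \<inter> P\<close>.\<close>

definition circle_frame :: "'a::euclidean_space set \<Rightarrow> 'a \<Rightarrow> 'a \<Rightarrow> bool" where
  "circle_frame C e1 e2 \<longleftrightarrow>
     norm e1 = 1 \<and> norm e2 = 1 \<and> e1 \<bullet> e2 = 0 \<and> C = sphere 0 1 \<inter> span {e1, e2}"

definition circle_param :: "'a::euclidean_space \<Rightarrow> 'a \<Rightarrow> real \<Rightarrow> 'a" where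
  "circle_param e1 e2 \<theta> = cos \<theta> *\<^sub>R e1 + sin \<theta> *\<^sub>R e2"

definition circle_fourier :: "('a::euclidean_space \<Rightarrow> real) \<Rightarrow> 'a \<Rightarrow> 'a \<Rightarrow> int \<Rightarrow> complex" where
  "circle_fourier f e1 e2 m =
     1 / (2 * of_real pi) *
     integral {0..2 * pi}
       (\<lambda>\<theta>. of_real (f (circle_param e1 e2 \<theta>)) * exp (- \<i> * of_int m * of_real \<theta>))"

text \<open>The single coefficients depend on the parametrization of \<open>C\<close>, but the vanishing of the pair
  does not; see \<open>fourier_pair_vanishes_iff\<close> below, and \<open>great_circle_iff\<close> for the existence of a
  parametrization.\<close>

definition fourier_pair_vanishes :: "('a::euclidean_space \<Rightarrow> real) \<Rightarrow> 'a set \<Rightarrow> int \<Rightarrow> bool" where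
  "fourier_pair_vanishes f C m \<longleftrightarrow>
     (\<forall>e1 e2. circle_frame C e1 e2 \<longrightarrow>
        circle_fourier f e1 e2 m = 0 \<and> circle_fourier f e1 e2 (- m) = 0)"

lemma great_circle_iff: "great_circle C \<longleftrightarrow> (\<exists>e1 e2. circle_frame C e1 e2)"
proof
  assume "great_circle C"
  then obtain P where P: "subspace P" "dim P = 2" "C = sphere 0 1 \<inter> P"
    unfolding great_circle_def by blast
  obtain B where B: "B \<subseteq> P" "pairwise orthogonal B" "\<And>x. x \<in> B \<Longrightarrow> norm x = 1"
      "independent B" "card B = dim P" "span B = P"
    using orthonormal_basis_subspace[OF P(1)] by metis
  obtain e1 e2 where e: "B = {e1, e2}" "e1 \<noteq> e2"
    using B(5) P(2) by (metis card_2_iff)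
  have "e1 \<bullet> e2 = 0"
    using B(2) e by (auto simp: pairwise_def orthogonal_def)
  then have "circle_frame C e1 e2"
    unfolding circle_frame_def using B P e by auto
  then show "\<exists>e1 e2. circle_frame C e1 e2" by blast
next
  assume "\<exists>e1 e2. circle_frame C e1 e2"
  then obtain e1 e2 where e: "norm e1 = 1" "norm e2 = 1" "e1 \<bullet> e2 = 0"
      "C = sphere 0 1 \<inter> span {e1, e2}"
    unfolding circle_frame_def by blast
  have ne: "e1 \<noteq> e2" "e1 \<noteq> 0" "e2 \<noteq> 0" using e by auto
  have "independent {e1, e2}"
    using e ne by (intro pairwise_orthogonal_independent)
      (auto simp: pairwise_def orthogonal_def inner_commute)
  then have "dim (span {e1, e2}) = 2"
    using ne dim_span_eq_card_independent[of "{e1, e2}"] by (metis card_2_iff)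
  then show "great_circle C"
    unfolding great_circle_def using e(4) subspace_span by blast
qed

lemma circle_frame_change:
  assumes "circle_frame C e1 e2" "circle_frame C d1 d2"
  obtains \<alpha> and s :: int where "s = 1 \<or> s = -1"
    "\<And>\<theta>. circle_param d1 d2 \<theta> = circle_param e1 e2 (\<alpha> + of_int s * \<theta>)"
proof -
  from assms(1) have e: "norm e1 = 1" "norm e2 = 1" "e1 \<bullet> e2 = 0"
      "C = sphere 0 1 \<inter> span {e1, e2}"
    by (auto simp: circle_frame_def)
  from assms(2) have d: "norm d1 = 1" "norm d2 = 1" "d1 \<bullet> d2 = 0"
      "C = sphere 0 1 \<inter> span {d1, d2}"
    by (auto simp: circle_frame_def)
  have e': "e1 \<bullet> e1 = 1" "e2 \<bullet> e2 = 1" "e2 \<bullet> e1 = 0"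
    using e by (auto simp: dot_square_norm inner_commute)
  have "d1 \<in> C" "d2 \<in> C" using d by (auto intro: span_base)
  then have "d1 \<in> span {e1, e2}" "d2 \<in> span {e1, e2}" using e by auto
  then obtain a b p q where d1: "d1 = a *\<^sub>R e1 + b *\<^sub>R e2" and d2: "d2 = p *\<^sub>R e1 + q *\<^sub>R e2"
    by (auto simp: span_insert span_singleton algebra_simps)
  have ab: "a\<^sup>2 + b\<^sup>2 = 1"
    using d(1) e e' by (simp add: d1 norm_eq_1 inner_add inner_simps power2_eq_square)
  have pq: "p\<^sup>2 + q\<^sup>2 = 1"
    using d(2) e e' by (simp add: d2 norm_eq_1 inner_add inner_simps power2_eq_square)
  have ort: "a * p + b * q = 0"
    using d(3) e e' by (simp add: d1 d2 inner_add inner_simps mult.commute)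
  obtain \<alpha> where al: "a = cos \<alpha>" "b = sin \<alpha>"
    using sincos_total_2pi[OF ab] by metis
  define s where "s = a * q - b * p"
  have q: "q = s * a" and p: "p = - s * b"
    using ab ort unfolding s_def by algebra+
  have "s\<^sup>2 = 1" using ab pq ort unfolding s_def by algebra
  then have s: "s = 1 \<or> s = -1" by (simp add: power2_eq_1_iff)
  have "circle_param d1 d2 \<theta> = circle_param e1 e2 (\<alpha> + s * \<theta>)" for \<theta>
    using s unfolding circle_param_def d1 d2 p q al
    by (auto simp: cos_add sin_add cos_diff sin_diff algebra_simps)
  then show thesis using that[of 1 \<alpha>] that[of "-1" \<alpha>] s by auto
qed

lemma integral_shift_period:
  fixes g :: "real \<Rightarrow> complex"
  assumes g: "continuous_on UNIV g" and per: "\<And>x. g (x + p) = g x" and "p \<ge> 0"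
  shows "integral {0..p} (\<lambda>x. g (x + c)) = integral {0..p} g"
proof -
  have pos: "integral {0..p} (\<lambda>x. h (x + t)) = integral {0..p} h"
    if t: "t \<ge> 0" and h: "continuous_on UNIV h" and perh: "\<And>x. h (x + p) = h x"
    for t and h :: "real \<Rightarrow> complex"
  proof -
    have int: "h integrable_on {a..b}" for a b
      using h continuous_on_subset integrable_continuous_interval by blast
    have sh: "integral {a..b} (\<lambda>x. h (x + r)) = integral {a + r..b + r} h" for a b r
      using integral_shift_Icc_real[of a b h r] by (simp add: o_def add.commute)
    have 1: "integral {0..t} h + integral {t..p + t} h = integral {0..p + t} h"
      using t \<open>p \<ge> 0\<close> int by (intro Henstock_Kurzweil_Integration.integral_combine) auto
    have 2: "integral {0..p} h + integral {p..p + t} h = integral {0..p + t} h"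
      using t \<open>p \<ge> 0\<close> int by (intro Henstock_Kurzweil_Integration.integral_combine) auto
    have 3: "integral {p..p + t} h = integral {0..t} h"
      using sh[of 0 t p] perh by (simp add: add.commute)
    have "integral {t..p + t} h = integral {0..p} h"
      using 1 2 unfolding 3 by (metis add.commute add_left_cancel)
    then show ?thesis using sh[of 0 p t] by simp
  qed
  show ?thesis
  proof (cases "c \<ge> 0")
    case False
    have "continuous_on UNIV (\<lambda>x. g (x + c))"
      by (intro continuous_on_compose2[OF g] continuous_intros) auto
    moreover have "g (x + p + c) = g (x + c)" for x
      using per[of "x + c"] by (simp add: add_ac)
    ultimately show ?thesis
      using pos[of "- c" "\<lambda>x. g (x + c)"] False by simp
  qed (use pos g per in blast)
qed

lemma circle_fourier_change:
  assumes f: "continuous_on C f" and e: "circle_frame C e1 e2" and s: "s = 1 \<or> s = -1"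
    and u: "\<And>\<theta>. circle_param d1 d2 \<theta> = circle_param e1 e2 (\<alpha> + of_int s * \<theta>)"
  shows "circle_fourier f d1 d2 m =
    exp (\<i> * of_int (s * m) * of_real \<alpha>) * circle_fourier f e1 e2 (s * m)"
proof -
  define h where "h = (\<lambda>\<theta>. complex_of_real (f (circle_param e1 e2 \<theta>)) *
    exp (- \<i> * of_int (s * m) * of_real \<theta>))"
  have inC: "circle_param e1 e2 \<theta> \<in> C" for \<theta>
  proof -
    have "circle_param e1 e2 \<theta> \<in> span {e1, e2}"
      unfolding circle_param_def by (intro span_add span_scale span_base) auto
    moreover have "norm (circle_param e1 e2 \<theta>) = 1"
      using e by (simp add: circle_param_def circle_frame_def norm_eq_1 inner_add
          inner_simps inner_commute flip: power2_eq_square)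
    ultimately show ?thesis using e by (auto simp: circle_frame_def)
  qed
  have "continuous_on UNIV (circle_param e1 e2)"
    unfolding circle_param_def by (intro continuous_intros)
  then have "continuous_on UNIV (\<lambda>\<theta>. f (circle_param e1 e2 \<theta>))"
    using continuous_on_compose2[OF f] inC by blast
  then have hc: "continuous_on UNIV h"
    unfolding h_def by (intro continuous_intros)
  have per: "h (x + 2 * pi) = h x" for x
  proof -
    have "- \<i> * of_int (s * m) * of_real (x + 2 * pi) =
        - \<i> * of_int (s * m) * of_real x + of_real (of_int (2 * (- s * m)) * pi) * \<i>"
      by (simp add: algebra_simps)
    then have "exp (- \<i> * of_int (s * m) * of_real (x + 2 * pi)) =
        exp (- \<i> * of_int (s * m) * of_real x)"
      by (simp only: exp_eq) blast
    then show ?thesis by (simp add: h_def circle_param_def)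
  qed
  have ih: "integral {0..2 * pi} (\<lambda>x. h (\<alpha> + of_int s * x)) = integral {0..2 * pi} h"
    using s
  proof
    assume "s = 1"
    then show ?thesis
      using integral_shift_period[OF hc per, of \<alpha>] by (simp add: add.commute)
  next
    assume s: "s = -1"
    define k where "k = (\<lambda>x. h (x + (\<alpha> - 2 * pi)))"
    have "integral {0..2 * pi} (\<lambda>x. h (\<alpha> - x)) =
        integral {- (2 * pi)..0} (\<lambda>x. h (x + \<alpha>))"
      using Henstock_Kurzweil_Integration.integral_reflect_real[of "2 * pi" 0 "\<lambda>x. h (\<alpha> - x)"]
      by (simp add: add.commute)
    also have "\<dots> = integral {0..2 * pi} k"
      using integral_shift_Icc_real[of 0 "2 * pi" "\<lambda>x. h (x + \<alpha>)" "- (2 * pi)"]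
      by (simp add: o_def k_def algebra_simps)
    also have "\<dots> = integral {0..2 * pi} h"
      unfolding k_def by (intro integral_shift_period hc per) simp
    finally show ?thesis using s by simp
  qed
  have "complex_of_real (f (circle_param d1 d2 \<theta>)) * exp (- \<i> * of_int m * of_real \<theta>) =
      exp (\<i> * of_int (s * m) * of_real \<alpha>) * h (\<alpha> + of_int s * \<theta>)" for \<theta>
    using s by (auto simp: h_def u algebra_simps simp flip: exp_add)
  then show ?thesis
    unfolding circle_fourier_def by (simp add: ih) (simp add: h_def)
qed

lemma fourier_pair_vanishes_iff:
  assumes f: "continuous_on C f" and e: "circle_frame C e1 e2"
  shows "fourier_pair_vanishes f C m \<longleftrightarrow>
    circle_fourier f e1 e2 m = 0 \<and> circle_fourier f e1 e2 (- m) = 0"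
proof
  assume *: "circle_fourier f e1 e2 m = 0 \<and> circle_fourier f e1 e2 (- m) = 0"
  show "fourier_pair_vanishes f C m"
    unfolding fourier_pair_vanishes_def
  proof (intro allI impI)
    fix d1 d2 assume "circle_frame C d1 d2"
    with e obtain \<alpha> and s :: int where s: "s = 1 \<or> s = -1"
      "\<And>\<theta>. circle_param d1 d2 \<theta> = circle_param e1 e2 (\<alpha> + of_int s * \<theta>)"
      by (rule circle_frame_change) blast
    show "circle_fourier f d1 d2 m = 0 \<and> circle_fourier f d1 d2 (- m) = 0"
      using * s(1) by (auto simp: circle_fourier_change[OF f e s])
  qed
qed (use e in \<open>auto simp: fourier_pair_vanishes_def\<close>)

end

theory Submission
  imports Defs
begin

text \<open>
The function splits into an even and an odd part, each of which inherits the vanishing of the second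
and of the third harmonic on great circles. An even function without second harmonic is constant and
an odd function without third harmonic is linear. Both facts come from one mean value property.
Let \<open>p = 0\<close> in the even case and \<open>p = 1\<close> in the odd case, let \<open>e\<close> be a unit vector, and choose a
three-dimensional subspace containing \<open>e\<close>. Then the average of \<open>F\<close> over the circle at height \<open>t\<close> above
the equator with pole \<open>e\<close> is \<open>t ^ p * F e\<close> (\<open>zonal_integral_eq\<close>).

To obtain it, let \<open>G t\<close> be the integral over the circle at height \<open>t\<close>. Along a great circle whose highest
point has height \<open>r\<close>, the height is \<open>r * cos \<theta>\<close>, and averaging the hypothesis over all these circles
(they differ by rotations about \<open>e\<close>) yields \<open>\<integral> G (r * cos \<theta>) * cos ((p + 2) * \<theta>) d\<theta> = 0\<close> for
every \<open>r\<close> in \<open>[0, 1]\<close> (\<open>zonal_integral_mode\<close>). This is an Abel integral equation. Putting \<open>r = w * sin \<alpha>\<close>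
and integrating against \<open>sin \<alpha> ^ (p + 3)\<close> replaces the cosine by a polynomial kernel in the height,
namely the Legendre polynomial of degree \<open>p + 2\<close>; by Weierstrass approximation it is enough to check
this change of kernel on powers of the height, where it is Wallis' product formula. The resulting
equation, valid at every scale \<open>w\<close>, can be differentiated in \<open>w\<close> and has only the solutions
\<open>G w = G 1 * w ^ p\<close> (\<open>power_law_of_cosine_moments\<close>).

In the even case the mean value property is a maximum principle: at a maximum \<open>e\<close> of \<open>F\<close> on the sphere
every latitude circle has average \<open>F e\<close>, hence \<open>F = F e\<close> on it, and these circles sweep out the sphere
(\<open>even_mode_two_imp_constant\<close>).

In the odd case extend \<open>F\<close> to a homogeneous function of degree one. Additivity involves only two vectors, so
it can be tested in a three-dimensional subspace, that is, on a function \<open>H\<close> on \<open>\<real>\<^sup>3\<close>. Integrate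
\<open>H x * (x \<bullet> e)\<close> against a radial weight. The rotations about \<open>e\<close> preserve the weight, the volume and
\<open>x \<bullet> e\<close>, and the mean value property says that averaging \<open>H\<close> over them leaves \<open>(x \<bullet> e) * H e\<close>. So the integral is a constant
multiple of \<open>H e\<close>, while it is visibly linear in \<open>e\<close> (\<open>homogeneous_mode_three_imp_linear_R3\<close>).
\<close>

section \<open>Measures on the unit interval with equal moments\<close>

text \<open>Both sides are integrals of \<open>G\<close> against signed measures on \<open>[0, 1]\<close>, the images of \<open>k\<close> under \<open>u\<close>
and of \<open>l\<close> under \<open>v\<close>. They agree on polynomials, and polynomials are uniformly dense. Comparing
moments avoids the substitution \<open>s = r * cos \<theta>\<close>, which is singular at \<open>\<theta> = 0\<close>.\<close>

lemma equal_moments_imp_equal_integrals: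
  fixes u k :: "'a::euclidean_space \<Rightarrow> real" and v l :: "'b::euclidean_space \<Rightarrow> real"
  assumes u: "continuous_on (cbox a b) u" "u ` cbox a b \<subseteq> {0..1}" and k: "continuous_on (cbox a b) k"
    and v: "continuous_on (cbox c d) v" "v ` cbox c d \<subseteq> {0..1}" and l: "continuous_on (cbox c d) l"
    and mom: "\<And>n. integral (cbox a b) (\<lambda>z. u z ^ n * k z) = integral (cbox c d) (\<lambda>z. v z ^ n * l z)"
    and G: "continuous_on {0..1} G"
  shows "integral (cbox a b) (\<lambda>z. G (u z) * k z) = integral (cbox c d) (\<lambda>z. G (v z) * l z)"
proof -
  have approx: "\<bar>integral (cbox p q) (\<lambda>z. G (w z) * m z) - integral (cbox p q) (\<lambda>z. P (w z) * m z)\<bar>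
      \<le> e * integral (cbox p q) (\<lambda>z. \<bar>m z\<bar>)"
    if w: "continuous_on (cbox p q) w" "w ` cbox p q \<subseteq> {0..1}" and m: "continuous_on (cbox p q) m"
      and P: "continuous_on {0..1} P" "\<And>x. x \<in> {0..1} \<Longrightarrow> \<bar>G x - P x\<bar> \<le> e"
    for w m :: "'c::euclidean_space \<Rightarrow> real" and p q P e
  proof -
    have c: "continuous_on (cbox p q) (\<lambda>z. H (w z) * m z)" if "continuous_on {0..1} H" for H :: "real \<Rightarrow> real"
      by (intro continuous_intros continuous_on_compose2[OF that w(1)] m w(2))
    have "norm (integral (cbox p q) (\<lambda>z. G (w z) * m z - P (w z) * m z))
        \<le> integral (cbox p q) (\<lambda>z. e * \<bar>m z\<bar>)"
    proof (rule integral_norm_bound_integral)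
      show "(\<lambda>z. G (w z) * m z - P (w z) * m z) integrable_on cbox p q"
        by (intro integrable_continuous continuous_intros c G P)
      show "(\<lambda>z. e * \<bar>m z\<bar>) integrable_on cbox p q"
        by (intro integrable_continuous continuous_intros m)
      show "norm (G (w z) * m z - P (w z) * m z) \<le> e * \<bar>m z\<bar>" if "z \<in> cbox p q" for z
        using P(2)[of "w z"] that w(2)
        by (auto simp: abs_mult simp flip: left_diff_distrib intro!: mult_right_mono)
    qed
    then show ?thesis
      by (simp add: integral_diff integrable_continuous c G P(1))
  qed
  define D where "D = integral (cbox a b) (\<lambda>z. \<bar>k z\<bar>) + integral (cbox c d) (\<lambda>z. \<bar>l z\<bar>)"
  have le: "\<bar>integral (cbox a b) (\<lambda>z. G (u z) * k z) - integral (cbox c d) (\<lambda>z. G (v z) * l z)\<bar> \<le> e * D"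
    if "e > 0" for e
  proof -
    obtain P where P: "real_polynomial_function P" "\<And>x. x \<in> {0..1} \<Longrightarrow> \<bar>G x - P x\<bar> < e"
      using Stone_Weierstrass_real_polynomial_function[OF _ G \<open>e > 0\<close>] by auto
    then obtain r n where Pn: "P = (\<lambda>x. \<Sum>i\<le>n. r i * x ^ i)"
      by (auto simp: real_polynomial_function_iff_sum)
    have Pc: "continuous_on {0..1} P"
      unfolding Pn by (intro continuous_intros)
    have "integral (cbox a b) (\<lambda>z. P (u z) * k z) = (\<Sum>i\<le>n. r i * integral (cbox a b) (\<lambda>z. u z ^ i * k z))"
      unfolding Pn sum_distrib_right
      by (subst integral_sum)
         (auto intro!: integrable_continuous continuous_intros u k simp: mult.assoc)
    moreover have "integral (cbox c d) (\<lambda>z. P (v z) * l z) = (\<Sum>i\<le>n. r i * integral (cbox c d) (\<lambda>z. v z ^ i * l z))"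
      unfolding Pn sum_distrib_right
      by (subst integral_sum)
         (auto intro!: integrable_continuous continuous_intros v l simp: mult.assoc)
    ultimately have eq: "integral (cbox a b) (\<lambda>z. P (u z) * k z) = integral (cbox c d) (\<lambda>z. P (v z) * l z)"
      using mom by simp
    show ?thesis
      using approx[OF u k Pc less_imp_le[OF P(2)]] approx[OF v l Pc less_imp_le[OF P(2)]] eq
      unfolding D_def by (simp add: algebra_simps)
  qed
  have "((\<lambda>e. e * D) \<longlongrightarrow> 0 * D) (at_right 0)"
    by (intro tendsto_intros)
  then have "\<bar>integral (cbox a b) (\<lambda>z. G (u z) * k z) - integral (cbox c d) (\<lambda>z. G (v z) * l z)\<bar> \<le> 0"
    using le by (intro tendsto_lowerbound[where F="at_right 0"])
      (auto simp: eventually_at_right_field intro!: exI[of _ 1])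
  then show ?thesis by simp
qed

section \<open>Inverting the cosine moments of a profile\<close>

definition wallis :: "nat \<Rightarrow> real" where
  "wallis n = integral {0..pi / 2} (\<lambda>x. cos x ^ n)"

lemma integral_sin_power: "integral {0..pi / 2} (\<lambda>x. sin x ^ n) = wallis n"
proof -
  have "integral {0..pi / 2} (\<lambda>x. sin x ^ n) = integral {- (pi/2)..0} (\<lambda>x. sin (x + pi/2) ^ n)"
    using integral_shift_Icc_real[of "-(pi/2)" 0 "\<lambda>x. sin x ^ n" "pi/2"] by (simp add: o_def add.commute)
  also have "\<dots> = integral {0..pi / 2} (\<lambda>x. cos x ^ n)"
    using Henstock_Kurzweil_Integration.integral_reflect_real[of "pi/2" 0 "\<lambda>x. cos x ^ n"]
    by (simp add: sin_add)
  finally show ?thesis by (simp add: wallis_def)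
qed

text \<open>The difference of the two integrands is the derivative of \<open>cos x ^ (n + 1) * sin x\<close>, which
vanishes at both ends of the interval.\<close>

lemma wallis_Suc_Suc: "(n + 2) * wallis (n + 2) = (n + 1) * wallis n"
proof -
  have "((\<lambda>x. (n + 2) * cos x ^ (n + 2) - (n + 1) * cos x ^ n) has_integral
      cos (pi/2) ^ (n + 1) * sin (pi/2) - cos 0 ^ (n + 1) * sin 0) {0..pi/2}"
  proof (rule fundamental_theorem_of_calculus)
    fix x :: real
    have "((\<lambda>x. cos x ^ (n + 1)) has_real_derivative (n + 1) * cos x ^ n * - sin x) (at x within {0..pi/2})"
      by (rule derivative_eq_intros refl | simp)+
    from DERIV_mult[OF this DERIV_subset[OF DERIV_sin]]
    have "((\<lambda>x. cos x ^ (n + 1) * sin x) has_real_derivative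
        (n + 1) * cos x ^ n * - sin x * sin x + cos x * cos x ^ (n + 1)) (at x within {0..pi/2})"
      by simp
    moreover have "(n + 1) * cos x ^ n * - sin x * sin x + cos x * cos x ^ (n + 1)
        = cos x ^ n * ((cos x)\<^sup>2 - (n + 1) * (sin x)\<^sup>2)"
      by (simp add: algebra_simps power2_eq_square)
    moreover have "\<dots> = (n + 2) * cos x ^ (n + 2) - (n + 1) * cos x ^ n"
      unfolding sin_squared_eq by (simp add: algebra_simps power2_eq_square)
    ultimately show "((\<lambda>x. cos x ^ (n + 1) * sin x) has_vector_derivative
        (n + 2) * cos x ^ (n + 2) - (n + 1) * cos x ^ n) (at x within {0..pi/2})"
      by (simp flip: has_real_derivative_iff_has_vector_derivative)
  qed auto
  then have "integral {0..pi/2} (\<lambda>x. (n + 2) * cos x ^ (n + 2) - (n + 1) * cos x ^ n) = 0"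
    by (simp add: integral_unique)
  then show ?thesis
    unfolding wallis_def
    by (subst (asm) integral_diff)
      (auto intro!: integrable_continuous_real continuous_intros simp: add_ac)
qed

text \<open>By the recursion, the left-hand side does not depend on \<open>n\<close>.\<close>

lemma wallis_mult_Suc: "(n + 1) * (wallis n * wallis (n + 1)) = pi / 2"
proof (induction n)
  case 0
  have "((\<lambda>x. cos x) has_integral sin (pi/2) - sin 0) {0..pi/2}"
    by (rule fundamental_theorem_of_calculus)
       (auto intro!: derivative_eq_intros simp flip: has_real_derivative_iff_has_vector_derivative)
  then have "wallis 1 = 1"
    by (simp add: wallis_def integral_unique)
  moreover have "wallis 0 = pi / 2"
    by (simp add: wallis_def)
  ultimately show ?case by simp
next
  case (Suc n)
  then show ?case
    using wallis_Suc_Suc[of n] by (simp add: algebra_simps)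
qed

lemma wallis_add2: "wallis (n + 2) = (n + 1) / (n + 2) * wallis n"
  using wallis_Suc_Suc[of n] by (simp add: field_simps)

text \<open>For \<open>p = 0\<close> and \<open>p = 1\<close> this is twice the Legendre polynomial of degree \<open>p + 2\<close>. For every
\<open>p\<close> it is orthogonal on \<open>[0, 1]\<close> to \<open>z ^ p\<close>, which makes \<open>z ^ p\<close> a solution of the scaled equation below.\<close>

definition legendre_kernel :: "nat \<Rightarrow> real \<Rightarrow> real" where
  "legendre_kernel p z = z ^ p * ((2 * p + 3) * z\<^sup>2 - (2 * p + 1))"

lemma integral_power_legendre_kernel:
  "integral {0..1} (\<lambda>z. z ^ k * legendre_kernel p z)
     = (2 * p + 3) / (k + p + 3) - (2 * p + 1) / (k + p + 1)"
proof -
  have "((\<lambda>z::real. z ^ k * legendre_kernel p z) has_integral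
     (2 * p + 3) / (k + p + 3) * 1 ^ (k + p + 3) - (2 * p + 1) / (k + p + 1) * 1 ^ (k + p + 1) -
     ((2 * p + 3) / (k + p + 3) * 0 ^ (k + p + 3) - (2 * p + 1) / (k + p + 1) * 0 ^ (k + p + 1))) {0..1}"
  proof (rule fundamental_theorem_of_calculus)
    fix z :: real
    have "((\<lambda>z. (2 * p + 3) / (k + p + 3) * z ^ (k + p + 3) - (2 * p + 1) / (k + p + 1) * z ^ (k + p + 1))
       has_real_derivative (2 * p + 3) * z ^ (k + p + 2) - (2 * p + 1) * z ^ (k + p)) (at z within {0..1})"
      by (rule derivative_eq_intros refl | simp)+
    moreover have "z ^ k * legendre_kernel p z = (2 * p + 3) * z ^ (k + p + 2) - (2 * p + 1) * z ^ (k + p)"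
      by (simp add: legendre_kernel_def power_add algebra_simps power2_eq_square)
    ultimately show "((\<lambda>z. (2 * p + 3) / (k + p + 3) * z ^ (k + p + 3) - (2 * p + 1) / (k + p + 1) * z ^ (k + p + 1))
       has_vector_derivative z ^ k * legendre_kernel p z) (at z within {0..1})"
      by (simp flip: has_real_derivative_iff_has_vector_derivative)
  qed auto
  then show ?thesis
    by (simp add: integral_unique power_0_left add_ac)
qed

text \<open>On powers \<open>z ^ k\<close> the double integral over \<open>\<alpha>\<close> and \<open>\<theta>\<close> of \<open>(sin \<alpha> * cos \<theta>) ^ k\<close>, weighted by
\<open>sin \<alpha> ^ (p + 3) * cos ((p + 2) * \<theta>)\<close>, factors into two Wallis integrals. Expanding the cosine of the multiple angle
in powers of \<open>cos \<theta>\<close> leaves a product of two consecutive Wallis integrals, which is rational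
in \<open>k\<close> up to the factor \<open>\<pi>\<close>; the exponent \<open>p + 3\<close> is chosen to make the two indices consecutive.\<close>

lemma wallis_legendre_moments:
  assumes "p \<in> {0, 1}"
  shows "wallis (k + p + 3) * integral {0..pi / 2} (\<lambda>x. cos x ^ k * cos (real (p + 2) * x))
    = pi / 4 * integral {0..1} (\<lambda>z. z ^ k * legendre_kernel p z)"
  using assms
proof (elim insertE emptyE)
  assume p: "p = 0"
  have "integral {0..pi / 2} (\<lambda>x. cos x ^ k * cos (real (p + 2) * x))
      = integral {0..pi / 2} (\<lambda>x. 2 * cos x ^ (k + 2) - cos x ^ k)"
    by (intro integral_cong) (simp add: p cos_double_cos right_diff_distrib power_add power2_eq_square)
  also have "\<dots> = 2 * wallis (k + 2) - wallis k"
    unfolding wallis_def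
    by (subst integral_diff) (auto intro!: integrable_continuous_real continuous_intros)
  also have "\<dots> = k / (k + 2) * wallis k"
    unfolding wallis_add2 by (simp add: divide_simps) (simp add: algebra_simps)
  finally have 1: "integral {0..pi / 2} (\<lambda>x. cos x ^ k * cos (real (p + 2) * x)) = k / (k + 2) * wallis k" .
  have 2: "wallis (k + p + 3) = (k + 2) / (k + 3) * wallis (k + 1)"
    using wallis_add2[of "k + 1"] by (simp add: p eval_nat_numeral add_ac)
  have 3: "wallis k * wallis (k + 1) = pi / (2 * (k + 1))"
    using wallis_mult_Suc[of k] by (simp add: field_simps)
  have "wallis (k + p + 3) * integral {0..pi / 2} (\<lambda>x. cos x ^ k * cos (real (p + 2) * x))
     = k / (k + 3) * (wallis k * wallis (k + 1))"
    unfolding 1 2 by (simp add: divide_simps)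
  also have "\<dots> = pi / 4 * integral {0..1} (\<lambda>z. z ^ k * legendre_kernel p z)"
    unfolding 3 integral_power_legendre_kernel p by (simp add: divide_simps)
  finally show ?thesis .
next
  assume p: "p = 1"
  have "integral {0..pi / 2} (\<lambda>x. cos x ^ k * cos (real (p + 2) * x))
      = integral {0..pi / 2} (\<lambda>x. 4 * cos x ^ (k + 3) - 3 * cos x ^ (k + 1))"
    by (intro integral_cong) (simp add: p cos_treble_cos right_diff_distrib power_add power3_eq_cube)
  also have "\<dots> = 4 * wallis (k + 3) - 3 * wallis (k + 1)"
    unfolding wallis_def
    by (subst integral_diff) (auto intro!: integrable_continuous_real continuous_intros)
  also have "wallis (k + 3) = (k + 2) / (k + 3) * wallis (k + 1)"
    using wallis_add2[of "k + 1"] by (simp add: eval_nat_numeral add_ac)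
  also have "4 * ((k + 2) / (k + 3) * wallis (k + 1)) - 3 * wallis (k + 1) = (real k - 1) / (k + 3) * wallis (k + 1)"
    by (simp add: divide_simps) (simp add: algebra_simps)
  finally have 1: "integral {0..pi / 2} (\<lambda>x. cos x ^ k * cos (real (p + 2) * x)) = (real k - 1) / (k + 3) * wallis (k + 1)" .
  have 2: "wallis (k + p + 3) = (k + 3) / (k + 4) * wallis (k + 2)"
    using wallis_add2[of "k + 2"] by (simp add: p eval_nat_numeral add_ac)
  have 3: "wallis (k + 1) * wallis (k + 2) = pi / (2 * (k + 2))"
    using wallis_mult_Suc[of "k + 1"] by (simp add: field_simps)
  have "wallis (k + p + 3) * integral {0..pi / 2} (\<lambda>x. cos x ^ k * cos (real (p + 2) * x))
     = (real k - 1) / (k + 4) * (wallis (k + 1) * wallis (k + 2))"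
    unfolding 1 2 by (simp add: divide_simps)
  also have "\<dots> = pi / 4 * integral {0..1} (\<lambda>z. z ^ k * legendre_kernel p z)"
    unfolding 3 integral_power_legendre_kernel p by (simp add: divide_simps) (simp add: algebra_simps)
  finally show ?thesis .
qed

text \<open>The inversion of the Abel equation: every inner integral over \<open>x\<close> vanishes because
\<open>r = w * sin \<alpha>\<close> stays in \<open>[0, 1]\<close>, and the double integral equals, by comparison of moments,
an integral of \<open>G\<close> against a polynomial kernel.\<close>

lemma integral_legendre_kernel_zero:
  assumes p: "p \<in> {0, 1}" and G: "continuous_on {0..1} G"
    and zero: "\<And>r. r \<in> {0..1} \<Longrightarrow> integral {0..pi / 2} (\<lambda>x. G (r * cos x) * cos (real (p + 2) * x)) = 0"
    and w: "w \<in> {0..1}"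
  shows "integral {0..1} (\<lambda>z. G (w * z) * legendre_kernel p z) = 0"
proof -
  define u where "u = (\<lambda>z::real \<times> real. sin (fst z) * cos (snd z))"
  define k where "k = (\<lambda>z::real \<times> real. sin (fst z) ^ (p + 3) * cos (real (p + 2) * snd z))"
  have iter: "integral (cbox (0, 0) (pi/2, pi/2)) (\<lambda>z. H (u z) * k z) =
      integral {0..pi/2} (\<lambda>\<alpha>. sin \<alpha> ^ (p + 3) * integral {0..pi/2} (\<lambda>x. H (sin \<alpha> * cos x) * cos (real (p + 2) * x)))"
    if "continuous_on {0..1} H" for H :: "real \<Rightarrow> real"
  proof -
    have "continuous_on (cbox (0, 0) (pi/2, pi/2)) (\<lambda>z. H (u z) * k z)"
      unfolding u_def k_def
      by (intro continuous_intros continuous_on_compose2[OF that])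
         (auto intro!: mult_nonneg_nonneg mult_le_one sin_ge_zero cos_ge_zero)
    then have "continuous_on (cbox (0, 0) (pi/2, pi/2)) (\<lambda>(\<alpha>, x). H (u (\<alpha>, x)) * k (\<alpha>, x))"
      by (simp add: case_prod_unfold)
    from integral_prod_continuous[OF this] show ?thesis
      by (simp add: case_prod_unfold u_def k_def mult_ac flip: integral_mult_right)
  qed
  have Gw: "continuous_on {0..1} (\<lambda>s. G (w * s))"
    by (rule continuous_on_compose2[OF G]) (use w in \<open>auto intro!: continuous_intros mult_le_one\<close>)
  have "integral (cbox (0, 0) (pi/2, pi/2)) (\<lambda>z. G (w * u z) * k z)
      = integral (cbox 0 1) (\<lambda>z. G (w * z) * (pi / 4 * legendre_kernel p z))"
  proof (rule equal_moments_imp_equal_integrals[OF _ _ _ _ _ _ _ Gw])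
    show "u ` cbox (0, 0) (pi/2, pi/2) \<subseteq> {0..1}"
      by (auto simp: u_def intro!: mult_nonneg_nonneg mult_le_one sin_ge_zero cos_ge_zero)
    fix n
    have "integral (cbox (0, 0) (pi/2, pi/2)) (\<lambda>z. u z ^ n * k z)
        = integral {0..pi/2} (\<lambda>\<alpha>. sin \<alpha> ^ (n + p + 3) * integral {0..pi/2} (\<lambda>x. cos x ^ n * cos (real (p + 2) * x)))"
      by (subst iter) (auto intro!: continuous_intros simp: power_mult_distrib power_add mult_ac
            simp flip: integral_mult_right)
    also have "\<dots> = wallis (n + p + 3) * integral {0..pi/2} (\<lambda>x. cos x ^ n * cos (real (p + 2) * x))"
      by (simp flip: integral_sin_power)
    also have "\<dots> = integral (cbox 0 1) (\<lambda>z. z ^ n * (pi / 4 * legendre_kernel p z))"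
      by (subst wallis_legendre_moments[OF p]) (simp add: mult_ac flip: integral_mult_right)
    finally show "integral (cbox (0, 0) (pi/2, pi/2)) (\<lambda>z. u z ^ n * k z)
        = integral (cbox 0 1) (\<lambda>z. z ^ n * (pi / 4 * legendre_kernel p z))" .
  qed (auto simp: u_def k_def legendre_kernel_def intro!: continuous_intros)
  also have "\<dots> = pi / 4 * integral {0..1} (\<lambda>z. G (w * z) * legendre_kernel p z)"
    by (simp add: mult_ac flip: integral_mult_right)
  moreover have "integral (cbox (0, 0) (pi/2, pi/2)) (\<lambda>z. G (w * u z) * k z) = 0"
  proof -
    have "integral {0..pi/2} (\<lambda>x. G (w * (sin \<alpha> * cos x)) * cos (real (p + 2) * x)) = 0"
      if "\<alpha> \<in> {0..pi/2}" for \<alpha>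
    proof -
      have "w * sin \<alpha> \<in> {0..1}"
        using w that by (auto intro!: mult_nonneg_nonneg mult_le_one sin_ge_zero)
      from zero[OF this] show ?thesis
        by (simp add: mult.assoc)
    qed
    then show ?thesis
      by (subst iter[OF Gw], subst integral_cong[where g="\<lambda>_. 0"]) auto
  qed
  ultimately show ?thesis by simp
qed

text \<open>With \<open>A w = \<integral>\<^sub>0\<^sup>w s ^ p * G s\<close> and \<open>B w = \<integral>\<^sub>0\<^sup>w s ^ (p + 2) * G s\<close> the hypothesis at scale \<open>w\<close>
reads \<open>(2 * p + 3) * B w = (2 * p + 1) * w\<^sup>2 * A w\<close>. Differentiating it gives the Euler equation
\<open>w * A' w = (2 * p + 1) * A w\<close>, so \<open>A\<close> is a multiple of \<open>w ^ (2 * p + 1)\<close>.\<close>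

lemma power_law_of_legendre_kernel:
  assumes G: "continuous_on {0..1} G"
    and zero: "\<And>w. w \<in> {0..1} \<Longrightarrow> integral {0..1} (\<lambda>z. G (w * z) * legendre_kernel p z) = 0"
    and w: "w \<in> {0..1}"
  shows "G w = G 1 * w ^ p"
proof -
  define A where "A = (\<lambda>w. integral {0..w} (\<lambda>s. s ^ p * G s))"
  define B where "B = (\<lambda>w. integral {0..w} (\<lambda>s. s ^ (p + 2) * G s))"
  have Gc: "continuous_on {0..w} G" if "w \<in> {0..1}" for w
    using G by (rule continuous_on_subset) (use that in auto)
  \<comment> \<open>Substituting s = w z in the hypothesis.\<close>
  have rel: "(2 * p + 3) * B w - (2 * p + 1) * (w\<^sup>2 * A w) = 0" if w: "w \<in> {0<..<1}" for w
  proof -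
    define h where "h = (\<lambda>s. (2 * p + 3) * (s ^ (p + 2) * G s) - (2 * p + 1) * w\<^sup>2 * (s ^ p * G s))"
    have "integral ((\<lambda>x. x / w) ` {0..w}) (\<lambda>z. h (w * z)) = (1 / w) * integral {0..w} h"
      using w by (subst integral_stretch_real) auto
    moreover have "(\<lambda>x. x / w) ` {0..w} = {0..1}"
      using w by (auto simp: image_iff intro!: bexI[of _ "_ * w"] mult_left_le_one_le)
    moreover have "h (w * z) = w ^ (p + 2) * (G (w * z) * legendre_kernel p z)" for z
      by (simp add: h_def legendre_kernel_def power_mult_distrib power_add power2_eq_square algebra_simps)
    ultimately have "integral {0..w} h = 0"
      using zero[of w] w by simp
    moreover have "integral {0..w} h = (2 * p + 3) * B w - (2 * p + 1) * w\<^sup>2 * A w"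
      unfolding h_def A_def B_def using w
      by (subst integral_diff) (auto intro!: integrable_continuous_real continuous_intros Gc)
    ultimately show ?thesis by (simp add: mult.assoc)
  qed
  have dA: "(A has_real_derivative w ^ p * G w) (at w)"
    and dB: "(B has_real_derivative w ^ (p + 2) * G w) (at w)" if w: "w \<in> {0<..<1}" for w
  proof -
    have at: "at w within {0..1} = at w"
      by (rule at_within_interior) (use w in auto)
    show "(A has_real_derivative w ^ p * G w) (at w)" "(B has_real_derivative w ^ (p + 2) * G w) (at w)"
      unfolding A_def B_def at[symmetric]
      by (rule integral_has_real_derivative; use w in \<open>auto intro!: continuous_intros G\<close>)+
  qed
  \<comment> \<open>The derivative of the relation between A and B.\<close>
  have AG: "w ^ (p + 1) * G w = (2 * p + 1) * A w" if w: "w \<in> {0<..<1}" for w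
  proof -
    have "((\<lambda>w. (2 * p + 3) * B w - (2 * p + 1) * (w\<^sup>2 * A w)) has_real_derivative
        (2 * p + 3) * (w ^ (p + 2) * G w) - (2 * p + 1) * (2 * w * A w + w ^ p * G w * w\<^sup>2)) (at w)"
      by (rule derivative_eq_intros dA dB refl w | simp)+
    moreover have "((\<lambda>w. (2 * p + 3) * B w - (2 * p + 1) * (w\<^sup>2 * A w)) has_real_derivative 0) (at w)"
      by (rule has_field_derivative_transform_within_open[where f="\<lambda>_. 0" and S="{0<..<1}"])
         (use w rel in auto)
    ultimately have "(2 * p + 3) * (w ^ (p + 2) * G w) - (2 * p + 1) * (2 * w * A w + w ^ p * G w * w\<^sup>2) = 0"
      using DERIV_unique by blast
    then have "2 * w * (w ^ (p + 1) * G w - (2 * p + 1) * A w) = 0"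
      by (simp add: power_add power2_eq_square algebra_simps)
    then show ?thesis using w by simp
  qed
  have "\<exists>c. \<forall>w\<in>{0<..<1}. A w / w ^ (2 * p + 1) = c"
  proof (rule has_field_derivative_zero_constant)
    fix w :: real assume w: "w \<in> {0<..<1}"
    have "((\<lambda>w. A w / w ^ (2 * p + 1)) has_real_derivative
        (w ^ p * G w * w ^ (2 * p + 1) - A w * ((2 * p + 1) * w ^ (2 * p))) / (w ^ (2 * p + 1) * w ^ (2 * p + 1))) (at w)"
      by (rule derivative_eq_intros dA refl w | use w in simp)+
    also have "w ^ p * G w * w ^ (2 * p + 1) - A w * ((2 * p + 1) * w ^ (2 * p))
        = w ^ (2 * p) * (w ^ (p + 1) * G w - (2 * p + 1) * A w)"
      by (simp add: algebra_simps)
    also have "\<dots> = 0"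
      using AG[OF w] by simp
    finally show "((\<lambda>w. A w / w ^ (2 * p + 1)) has_real_derivative 0) (at w within {0<..<1})"
      using has_field_derivative_at_within by simp
  qed auto
  then obtain c where c: "\<And>w. w \<in> {0<..<1} \<Longrightarrow> A w / w ^ (2 * p + 1) = c" by blast
  have inner: "G w - (2 * p + 1) * c * w ^ p = 0" if w: "w \<in> {0<..<1}" for w
  proof -
    have "A w = c * w ^ (2 * p + 1)"
      using c[OF w] w by (simp add: field_simps)
    also have "\<dots> = c * (w ^ (p + 1) * w ^ p)"
      by (simp add: mult_2 power_add)
    finally have "w ^ (p + 1) * G w = w ^ (p + 1) * ((2 * p + 1) * c * w ^ p)"
      unfolding AG[OF w] by (simp add: mult_ac)
    then show ?thesis using w by simp
  qed
  have cont: "continuous_on (closure {0<..<1}) (\<lambda>w. G w - (2 * p + 1) * c * w ^ p)"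
    by (auto intro!: continuous_intros G)
  have lim: "G w - (2 * p + 1) * c * w ^ p = 0" if "w \<in> {0..1}" for w
    using continuous_constant_on_closure[OF cont inner] that by simp
  show ?thesis
    using lim[OF w] lim[of 1] by simp
qed

lemma power_law_of_cosine_moments:
  assumes "p \<in> {0, 1}" and "continuous_on {0..1} G"
    and "\<And>r. r \<in> {0..1} \<Longrightarrow> integral {0..pi / 2} (\<lambda>x. G (r * cos x) * cos (real (p + 2) * x)) = 0"
    and "w \<in> {0..1}"
  shows "G w = G 1 * w ^ p"
  using assms by (intro power_law_of_legendre_kernel integral_legendre_kernel_zero) auto

section \<open>Integrals along circles\<close>

lemma integral_shift_period_real:
  fixes g :: "real \<Rightarrow> real"
  assumes g: "continuous_on UNIV g" and per: "\<And>x. g (x + p) = g x" and "p \<ge> 0"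
  shows "integral {0..p} (\<lambda>x. g (x + c)) = integral {0..p} g"
proof -
  have of_real: "integral {0..p} (\<lambda>x. complex_of_real (h x)) = of_real (integral {0..p} h)"
    if "continuous_on UNIV h" for h :: "real \<Rightarrow> real"
    using integral_linear[OF integrable_continuous_real bounded_linear_of_real, of 0 p h]
      continuous_on_subset[OF that, of "{0..p}"] by (simp add: o_def)
  have "continuous_on UNIV (\<lambda>x. g (x + c))"
    by (intro continuous_on_compose2[OF g] continuous_intros) auto
  then show ?thesis
    using integral_shift_period[of "\<lambda>x. complex_of_real (g x)" p c] assms
    by (simp add: of_real continuous_on_of_real)
qed

lemma integral_reflect_shift:
  fixes h :: "real \<Rightarrow> real"
  shows "integral {a..b} (\<lambda>x. h (c - x)) = integral {c - b..c - a} h"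
  using Henstock_Kurzweil_Integration.integral_reflect_real[of b a "\<lambda>x. h (c - x)"]
    integral_shift_Icc_real[of "-b" "-a" h c]
  by (simp add: o_def algebra_simps)

text \<open>Reflection in both axes of the circle maps each quarter to the first one.\<close>

lemma integral_quarter_symmetry:
  fixes h :: "real \<Rightarrow> real"
  assumes h: "continuous_on UNIV h" and sym: "\<And>x. h (2 * pi - x) = h x" "\<And>x. h (pi - x) = h x"
  shows "integral {0..2 * pi} h = 4 * integral {0..pi / 2} h"
proof -
  have int: "h integrable_on {a..b}" for a b
    using h continuous_on_subset integrable_continuous_interval by blast
  have "integral {0..pi} h + integral {pi..2 * pi} h = integral {0..2 * pi} h"
    by (intro Henstock_Kurzweil_Integration.integral_combine int) auto
  moreover have "integral {pi..2 * pi} h = integral {0..pi} h"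
    using integral_reflect_shift[of 0 pi h "2 * pi"] by (simp add: sym)
  moreover have "integral {0..pi / 2} h + integral {pi / 2..pi} h = integral {0..pi} h"
    by (intro Henstock_Kurzweil_Integration.integral_combine int) auto
  moreover have "integral {pi / 2..pi} h = integral {0..pi / 2} h"
    using integral_reflect_shift[of 0 "pi / 2" h pi] by (simp add: sym)
  ultimately show ?thesis by simp
qed

lemma cos_nat_mult_2pi_minus: "cos (real n * (2 * pi - x)) = cos (real n * x)"
proof -
  have "real n * (2 * pi - x) = 2 * real n * pi - real n * x"
    by (simp add: algebra_simps)
  then show ?thesis by (simp only: cos_diff cos_2npi sin_2npi)
qed

lemma cos_nat_mult_pi_minus: "cos (real n * (pi - x)) = (- 1) ^ n * cos (real n * x)"
  using cos_diff[of "real n * pi" "real n * x"] by (simp add: right_diff_distrib)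

lemma polar_coordinates:
  obtains \<delta> :: real where "x = sqrt (x\<^sup>2 + y\<^sup>2) * cos \<delta>" "y = sqrt (x\<^sup>2 + y\<^sup>2) * sin \<delta>"
proof (cases "x\<^sup>2 + y\<^sup>2 = 0")
  case True
  then show ?thesis using that by (simp add: sum_power2_eq_zero_iff)
next
  case False
  define \<rho> where "\<rho> = sqrt (x\<^sup>2 + y\<^sup>2)"
  have \<rho>: "\<rho> \<noteq> 0" "\<rho>\<^sup>2 = x\<^sup>2 + y\<^sup>2"
    using False by (simp_all add: \<rho>_def)
  then have "(x / \<rho>)\<^sup>2 + (y / \<rho>)\<^sup>2 = 1"
    using False by (simp add: power_divide flip: add_divide_distrib)
  then obtain \<delta> where "x / \<rho> = cos \<delta>" "y / \<rho> = sin \<delta>"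
    using sincos_total_2pi by metis
  then have "\<rho> * cos \<delta> = x" "\<rho> * sin \<delta> = y"
    using \<rho>(1) by (auto simp flip: \<open>x / \<rho> = cos \<delta>\<close> \<open>y / \<rho> = sin \<delta>\<close>)
  then show ?thesis
    using that[of \<delta>] unfolding \<rho>_def by metis
qed

lemma circle_param_rotate:
  "x *\<^sub>R circle_param b c \<phi> + y *\<^sub>R circle_param b c (\<phi> + pi / 2)
     = (x * cos \<phi> - y * sin \<phi>) *\<^sub>R b + (x * sin \<phi> + y * cos \<phi>) *\<^sub>R c"
  by (simp add: circle_param_def cos_add sin_add algebra_simps)

lemma circle_param_add:
  "circle_param b c (\<phi> + \<delta>) = cos \<delta> *\<^sub>R circle_param b c \<phi> + sin \<delta> *\<^sub>R circle_param b c (\<phi> + pi / 2)"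
  by (simp add: circle_param_rotate) (simp add: circle_param_def cos_add sin_add algebra_simps)

lemma circle_param_periodic [simp]: "circle_param b c (\<phi> + 2 * pi) = circle_param b c \<phi>"
  by (simp add: circle_param_def)

lemma continuous_on_circle_param [continuous_intros]:
  fixes h :: "'b::t2_space \<Rightarrow> real"
  assumes "continuous_on A f" "continuous_on A g" "continuous_on A h"
  shows "continuous_on A (\<lambda>x. circle_param (f x) (g x) (h x))"
  unfolding circle_param_def by (intro continuous_intros assms)

text \<open>Two orthogonal vectors of constant lengths that rotate together add up to one rotating vector
with a phase shift, and the phase is lost in the integral over a full period.\<close>

lemma integral_circle_rotate:
  fixes F :: "'a::euclidean_space \<Rightarrow> real"
  assumes F: "continuous_on UNIV F"
  shows "integral {0..2 * pi} (\<lambda>\<phi>. F (a + x *\<^sub>R circle_param b c \<phi> + y *\<^sub>R circle_param b c (\<phi> + pi / 2)))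
    = integral {0..2 * pi} (\<lambda>\<phi>. F (a + sqrt (x\<^sup>2 + y\<^sup>2) *\<^sub>R circle_param b c \<phi>))"
proof -
  obtain \<delta> where \<delta>: "x = sqrt (x\<^sup>2 + y\<^sup>2) * cos \<delta>" "y = sqrt (x\<^sup>2 + y\<^sup>2) * sin \<delta>"
    by (rule polar_coordinates)
  define \<rho> where "\<rho> = sqrt (x\<^sup>2 + y\<^sup>2)"
  have eq: "a + x *\<^sub>R circle_param b c \<phi> + y *\<^sub>R circle_param b c (\<phi> + pi / 2)
      = a + \<rho> *\<^sub>R circle_param b c (\<phi> + \<delta>)" for \<phi>
    unfolding circle_param_add[of b c \<phi> \<delta>] using \<delta>[folded \<rho>_def]
    by (simp add: algebra_simps)
  show ?thesis
    unfolding eq \<rho>_def[symmetric]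
  proof (rule integral_shift_period_real[where g="\<lambda>\<phi>. F (a + \<rho> *\<^sub>R circle_param b c \<phi>)"])
    show "continuous_on UNIV (\<lambda>\<phi>. F (a + \<rho> *\<^sub>R circle_param b c \<phi>))"
      by (intro continuous_on_compose2[OF F] continuous_intros) auto
  qed simp_all
qed

section \<open>Integrals over latitude circles\<close>

definition orthonormal_triple :: "'a::euclidean_space \<Rightarrow> 'a \<Rightarrow> 'a \<Rightarrow> bool" where
  "orthonormal_triple e b c \<longleftrightarrow> norm e = 1 \<and> norm b = 1 \<and> norm c = 1
     \<and> e \<bullet> b = 0 \<and> e \<bullet> c = 0 \<and> b \<bullet> c = 0"

lemma orthonormal_triple_inner:
  assumes "orthonormal_triple e b c"
  shows "e \<bullet> e = 1" "b \<bullet> b = 1" "c \<bullet> c = 1" "e \<bullet> b = 0" "e \<bullet> c = 0" "b \<bullet> c = 0"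
    "b \<bullet> e = 0" "c \<bullet> e = 0" "c \<bullet> b = 0"
  using assms by (auto simp: orthonormal_triple_def dot_square_norm inner_commute)

text \<open>For \<open>m > 0\<close>, rotating the frame \<open>(u, v)\<close> by a quarter of the period of the harmonic turns its cosine coefficient into the
sine coefficient, so the quantification over all frames covers both.\<close>

definition mode_vanishes :: "nat \<Rightarrow> ('a::euclidean_space \<Rightarrow> real) \<Rightarrow> bool" where
  "mode_vanishes m F \<longleftrightarrow> (\<forall>u v. norm u = 1 \<longrightarrow> norm v = 1 \<longrightarrow> u \<bullet> v = 0 \<longrightarrow>
     integral {0..2 * pi} (\<lambda>\<theta>. F (circle_param u v \<theta>) * cos (m * \<theta>)) = 0)"

text \<open>For \<open>\<bar>t\<bar> > 1\<close> the root of a negative number is negative, not undefined, so that this is a continuous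
function of \<open>t\<close> on the whole line.\<close>

definition zonal_integral :: "('a::euclidean_space \<Rightarrow> real) \<Rightarrow> 'a \<Rightarrow> 'a \<Rightarrow> 'a \<Rightarrow> real \<Rightarrow> real" where
  "zonal_integral F e b c t =
     integral {0..2 * pi} (\<lambda>\<phi>. F (t *\<^sub>R e + sqrt (1 - t\<^sup>2) *\<^sub>R circle_param b c \<phi>))"

lemma continuous_on_zonal_integral:
  assumes F: "continuous_on UNIV F"
  shows "continuous_on UNIV (zonal_integral F e b c)"
proof -
  have "continuous_on (UNIV \<times> cbox 0 (2 * pi))
      (\<lambda>(t, \<phi>). F (t *\<^sub>R e + sqrt (1 - t\<^sup>2) *\<^sub>R circle_param b c \<phi>))"
    unfolding case_prod_unfold
    by (intro continuous_on_compose2[OF F] continuous_intros) auto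
  from integral_continuous_on_param[OF this] show ?thesis
    unfolding zonal_integral_def by simp
qed

text \<open>The great circle spanned by \<open>r *\<^sub>R e + sqrt (1 - r\<^sup>2) *\<^sub>R d\<close> (its highest point if \<open>r \<ge> 0\<close>) and by the
horizontal direction orthogonal to \<open>d\<close> has height \<open>r * cos \<theta>\<close> at parameter \<open>\<theta>\<close>. When \<open>d\<close> runs through the
equator, the point at parameter \<open>\<theta>\<close> runs through the whole latitude circle of that height.\<close>

lemma zonal_integral_mode:
  fixes F :: "'a::euclidean_space \<Rightarrow> real"
  assumes F: "continuous_on UNIV F" and m: "mode_vanishes m F" and ebc: "orthonormal_triple e b c"
    and r: "\<bar>r\<bar> \<le> 1"
  shows "integral {0..2 * pi} (\<lambda>\<theta>. zonal_integral F e b c (r * cos \<theta>) * cos (m * \<theta>)) = 0"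
proof -
  define s where "s = sqrt (1 - r\<^sup>2)"
  have s2: "s\<^sup>2 = 1 - r\<^sup>2"
    using r by (simp add: s_def abs_square_le_1)
  define u where "u = (\<lambda>\<phi>. r *\<^sub>R e + s *\<^sub>R circle_param b c \<phi>)"
  define v where "v = (\<lambda>\<phi>. circle_param b c (\<phi> + pi / 2))"
  note inn = orthonormal_triple_inner[OF ebc]
  have uv: "norm (u \<phi>) = 1" "norm (v \<phi>) = 1" "u \<phi> \<bullet> v \<phi> = 0" for \<phi>
  proof -
    have "u \<phi> \<bullet> u \<phi> = r * r + (s * s * (cos \<phi> * cos \<phi>) + s * s * (sin \<phi> * sin \<phi>))"
      by (simp add: u_def circle_param_def inner_simps inn algebra_simps)
    also have "\<dots> = r\<^sup>2 + s\<^sup>2 * ((cos \<phi>)\<^sup>2 + (sin \<phi>)\<^sup>2)"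
      by (simp only: power2_eq_square distrib_left)
    finally show "norm (u \<phi>) = 1"
      by (simp add: s2 norm_eq_1)
    have "v \<phi> \<bullet> v \<phi> = 1"
      using sin_cos_squared_add3[of \<phi>]
      by (simp add: v_def circle_param_def sin_add cos_add inner_simps inn)
    then show "norm (v \<phi>) = 1"
      by (simp add: norm_eq_1)
    show "u \<phi> \<bullet> v \<phi> = 0"
      by (simp add: u_def v_def circle_param_def sin_add cos_add inner_simps inn algebra_simps)
  qed
  have zon: "integral {0..2 * pi} (\<lambda>\<phi>. F (circle_param (u \<phi>) (v \<phi>) \<theta>))
      = zonal_integral F e b c (r * cos \<theta>)" for \<theta>
  proof -
    have sq: "(s * cos \<theta>)\<^sup>2 + (sin \<theta>)\<^sup>2 = 1 - (r * cos \<theta>)\<^sup>2"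
      by (simp add: power_mult_distrib s2 sin_squared_eq algebra_simps)
    have "circle_param (u \<phi>) (v \<phi>) \<theta> = (r * cos \<theta>) *\<^sub>R e
        + (s * cos \<theta>) *\<^sub>R circle_param b c \<phi> + sin \<theta> *\<^sub>R circle_param b c (\<phi> + pi / 2)" for \<phi>
      by (subst circle_param_def) (simp add: u_def v_def scaleR_add_right mult_ac)
    then show ?thesis
      using integral_circle_rotate[OF F, of "(r * cos \<theta>) *\<^sub>R e" "s * cos \<theta>" b c "sin \<theta>"]
      by (simp add: zonal_integral_def sq)
  qed
  have cont: "continuous_on (cbox (0, 0) (2 * pi, 2 * pi))
      (\<lambda>(\<theta>, \<phi>). F (circle_param (u \<phi>) (v \<phi>) \<theta>) * cos (m * \<theta>))"
    unfolding case_prod_unfold u_def v_def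
    by (intro continuous_on_compose2[OF F] continuous_intros) auto
  have "integral {0..2 * pi} (\<lambda>\<theta>. zonal_integral F e b c (r * cos \<theta>) * cos (m * \<theta>))
      = integral {0..2 * pi} (\<lambda>\<theta>. integral {0..2 * pi} (\<lambda>\<phi>. F (circle_param (u \<phi>) (v \<phi>) \<theta>) * cos (m * \<theta>)))"
    by (simp flip: zon)
  also have "\<dots> = integral {0..2 * pi} (\<lambda>\<phi>. integral {0..2 * pi} (\<lambda>\<theta>. F (circle_param (u \<phi>) (v \<phi>) \<theta>) * cos (m * \<theta>)))"
    using integral_swap_continuous[OF cont] by simp
  also have "\<dots> = 0"
    using m uv by (simp add: mode_vanishes_def)
  finally show ?thesis .
qed

lemma zonal_integral_one:
  "zonal_integral F e b c 1 = 2 * pi * F e"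
  by (simp add: zonal_integral_def)

lemma zonal_integral_minus:
  assumes F: "continuous_on UNIV F" and par: "\<And>x. F (- x) = (- 1) ^ p * F x"
  shows "zonal_integral F e b c (- t) = (- 1) ^ p * zonal_integral F e b c t"
proof -
  have "F (- t *\<^sub>R e + \<rho> *\<^sub>R circle_param b c \<phi>)
      = (- 1) ^ p * F (t *\<^sub>R e + \<rho> *\<^sub>R circle_param b c (\<phi> + pi))" for \<rho> \<phi>
    by (simp add: circle_param_def algebra_simps flip: par)
  then have "zonal_integral F e b c (- t)
      = (- 1) ^ p * integral {0..2 * pi} (\<lambda>\<phi>. F (t *\<^sub>R e + sqrt (1 - t\<^sup>2) *\<^sub>R circle_param b c (\<phi> + pi)))"
    by (simp add: zonal_integral_def flip: integral_mult_right)
  also have "integral {0..2 * pi} (\<lambda>\<phi>. F (t *\<^sub>R e + sqrt (1 - t\<^sup>2) *\<^sub>R circle_param b c (\<phi> + pi)))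
      = zonal_integral F e b c t"
    unfolding zonal_integral_def
  proof (rule integral_shift_period_real[where
        g="\<lambda>\<phi>. F (t *\<^sub>R e + sqrt (1 - t\<^sup>2) *\<^sub>R circle_param b c \<phi>)"])
    show "continuous_on UNIV (\<lambda>\<phi>. F (t *\<^sub>R e + sqrt (1 - t\<^sup>2) *\<^sub>R circle_param b c \<phi>))"
      by (intro continuous_on_compose2[OF F] continuous_intros) auto
  qed (simp_all add: add.assoc[symmetric])
  finally show ?thesis .
qed

text \<open>The mean value property. The parity of \<open>F\<close> makes the profile even or odd in \<open>t\<close>, which first
reduces the integral of \<open>zonal_integral_mode\<close> to a quarter period and then extends the power law
from \<open>[0, 1]\<close> to negative heights.\<close>

proposition zonal_integral_eq:
  fixes F :: "'a::euclidean_space \<Rightarrow> real"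
  assumes p: "p \<in> {0, 1}" and F: "continuous_on UNIV F" and m: "mode_vanishes (p + 2) F"
    and par: "\<And>x. F (- x) = (- 1) ^ p * F x"
    and ebc: "orthonormal_triple e b c" and t: "\<bar>t\<bar> \<le> 1"
  shows "zonal_integral F e b c t = 2 * pi * t ^ p * F e"
proof -
  define G where "G = zonal_integral F e b c"
  have G: "continuous_on UNIV G"
    unfolding G_def by (rule continuous_on_zonal_integral[OF F])
  have Gm: "G (- x) = (- 1) ^ p * G x" for x
    unfolding G_def by (rule zonal_integral_minus[OF F par])
  have pos: "G w = G 1 * w ^ p" if "w \<in> {0..1}" for w
  proof (rule power_law_of_cosine_moments[OF p _ _ that])
    show "continuous_on {0..1} G"
      using G continuous_on_subset by blast
    fix r :: real assume r: "r \<in> {0..1}"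
    define h where "h = (\<lambda>\<theta>. G (r * cos \<theta>) * cos (real (p + 2) * \<theta>))"
    have "integral {0..2 * pi} h = 4 * integral {0..pi / 2} h"
    proof (rule integral_quarter_symmetry)
      show "continuous_on UNIV h"
        unfolding h_def by (intro continuous_on_compose2[OF G] continuous_intros) auto
      show "h (2 * pi - x) = h x" for x
        unfolding h_def cos_nat_mult_2pi_minus by (simp add: cos_diff)
      show "h (pi - x) = h x" for x
        unfolding h_def cos_nat_mult_pi_minus using p by (auto simp: Gm)
    qed
    moreover have "integral {0..2 * pi} h = 0"
      unfolding h_def G_def using zonal_integral_mode[OF F m ebc, of r] r by simp
    ultimately show "integral {0..pi / 2} (\<lambda>\<theta>. G (r * cos \<theta>) * cos (real (p + 2) * \<theta>)) = 0"
      by (simp add: h_def)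
  qed
  have "G t = G 1 * t ^ p"
  proof (cases "t \<ge> 0")
    case False
    then have "G t = (- 1) ^ p * (G 1 * (- t) ^ p)"
      using pos[of "- t"] Gm[of "- t"] t by simp
    then show ?thesis using p by auto
  qed (use pos[of t] t in simp)
  then show ?thesis
    by (simp add: G_def zonal_integral_one)
qed

section \<open>Even functions\<close>

lemma unit_orthogonal_exists:
  fixes S :: "'a::euclidean_space set"
  assumes "finite S" "card S < DIM('a)"
  obtains c where "norm c = 1" "\<And>y. y \<in> S \<Longrightarrow> y \<bullet> c = 0"
proof -
  have "dim S < DIM('a)"
    using dim_le_card'[OF assms(1)] assms(2) by linarith
  then obtain x where x: "x \<noteq> 0" "\<And>y. y \<in> span S \<Longrightarrow> orthogonal x y"
    by (rule orthogonal_to_subspace_exists) blast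
  have "y \<bullet> sgn x = 0" if "y \<in> S" for y
    using x(2)[OF span_base[OF that]] by (simp add: sgn_div_norm orthogonal_def inner_commute)
  then show ?thesis
    using that[of "sgn x"] x(1) by (simp add: norm_sgn)
qed

lemma orthogonal_decomposition:
  fixes e x :: "'a::euclidean_space"
  assumes "norm e = 1" "DIM('a) \<ge> 2"
  obtains b s where "norm b = 1" "e \<bullet> b = 0" "s \<ge> 0" "x = (x \<bullet> e) *\<^sub>R e + s *\<^sub>R b"
proof (cases "x = (x \<bullet> e) *\<^sub>R e")
  case True
  obtain b where "norm b = 1" "e \<bullet> b = 0"
    using unit_orthogonal_exists[of "{e}"] assms(2) by auto
  then show ?thesis using that[of b 0] True by simp
next
  case False
  define y where "y = x - (x \<bullet> e) *\<^sub>R e"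
  have "e \<bullet> y = 0"
    using assms(1) by (simp add: y_def inner_diff_right inner_commute dot_square_norm)
  then have "e \<bullet> sgn y = 0"
    by (simp add: sgn_div_norm)
  moreover have "norm (sgn y) = 1"
    using False by (simp add: norm_sgn y_def)
  moreover have "x = (x \<bullet> e) *\<^sub>R e + norm y *\<^sub>R sgn y"
    using False by (simp add: sgn_div_norm y_def)
  ultimately show ?thesis using that[of "sgn y" "norm y"] by simp
qed

lemma orthonormal_triple_extend:
  fixes e b :: "'a::euclidean_space"
  assumes "DIM('a) \<ge> 3" "norm e = 1" "norm b = 1" "e \<bullet> b = 0"
  obtains c where "orthonormal_triple e b c"
proof (rule unit_orthogonal_exists[of "{e, b}"])
  show "card {e, b} < DIM('a)"
    using assms(1) by (simp add: card_insert_if)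
qed (use assms that in \<open>auto simp: orthonormal_triple_def\<close>)

lemma norm_circle_param:
  assumes "norm u = 1" "norm v = 1" "u \<bullet> v = 0"
  shows "norm (circle_param u v \<theta>) = 1"
proof -
  have inn: "u \<bullet> u = 1" "v \<bullet> v = 1" "v \<bullet> u = 0"
    using assms by (auto simp: dot_square_norm inner_commute)
  have "circle_param u v \<theta> \<bullet> circle_param u v \<theta> = 1"
    using sin_cos_squared_add3[of \<theta>]
    by (simp add: circle_param_def inner_simps inn assms(3))
  then show ?thesis by (simp add: norm_eq_1)
qed

lemma norm_latitude_point:
  assumes "orthonormal_triple e b c"
  shows "(norm (t *\<^sub>R e + s *\<^sub>R circle_param b c \<phi>))\<^sup>2 = t\<^sup>2 + s\<^sup>2"
proof -
  have "norm (circle_param b c \<phi>) = 1"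
    using assms by (intro norm_circle_param) (auto simp: orthonormal_triple_def)
  moreover have "e \<bullet> circle_param b c \<phi> = 0"
    by (simp add: circle_param_def inner_simps orthonormal_triple_inner[OF assms])
  ultimately show ?thesis
    using assms by (subst norm_add_Pythagorean)
      (auto simp: orthogonal_def orthonormal_triple_def)
qed

lemma unit_circle_upper:
  fixes s t :: real
  assumes "t\<^sup>2 + s\<^sup>2 = 1" "s \<ge> 0"
  shows "s = sqrt (1 - t\<^sup>2)" "\<bar>t\<bar> \<le> 1"
proof -
  have "s\<^sup>2 = 1 - t\<^sup>2" using assms(1) by simp
  then show "s = sqrt (1 - t\<^sup>2)"
    using assms(2) by (metis real_sqrt_unique)
  have "t\<^sup>2 \<le> 1"
    using assms(1) zero_le_power2[of s] by linarith
  then show "\<bar>t\<bar> \<le> 1"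
    by (simp add: abs_square_le_1)
qed

text \<open>A maximum principle. At a maximum \<open>e\<close> the function \<open>F e - F\<close> is nonnegative with integral zero on
each latitude circle about \<open>e\<close>, and every point of the sphere lies on such a circle.\<close>

proposition even_mode_two_imp_constant:
  fixes F :: "'a::euclidean_space \<Rightarrow> real"
  assumes dim: "DIM('a) \<ge> 3" and F: "continuous_on UNIV F" and m: "mode_vanishes 2 F"
    and even: "\<And>x. F (- x) = F x"
  shows "\<exists>c. \<forall>x\<in>sphere 0 1. F x = c"
proof -
  have "\<exists>e\<in>sphere 0 1. \<forall>y\<in>sphere 0 1. F y \<le> F e"
    using dim by (intro continuous_attains_sup continuous_on_subset[OF F]) auto
  then obtain e where e: "norm e = 1" and max: "\<And>y. norm y = 1 \<Longrightarrow> F y \<le> F e"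
    by auto
  have "F x = F e" if x: "norm x = 1" for x
  proof -
    define t where "t = x \<bullet> e"
    obtain b s where b: "norm b = 1" "e \<bullet> b = 0" and s: "s \<ge> 0" and xeq: "x = t *\<^sub>R e + s *\<^sub>R b"
      using orthogonal_decomposition[OF e, of x] dim unfolding t_def by auto
    obtain c where ebc: "orthonormal_triple e b c"
      using orthonormal_triple_extend[OF dim e b] .
    have "t\<^sup>2 + s\<^sup>2 = 1"
      using norm_latitude_point[OF ebc, of t s 0] x by (simp add: xeq circle_param_def)
    then have s_eq: "s = sqrt (1 - t\<^sup>2)" and t: "\<bar>t\<bar> \<le> 1"
      using unit_circle_upper[OF _ s] by auto
    define h where "h = (\<lambda>\<phi>. F e - F (t *\<^sub>R e + s *\<^sub>R circle_param b c \<phi>))"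
    have c1: "continuous_on {0..2 * pi} (\<lambda>\<phi>. F (t *\<^sub>R e + s *\<^sub>R circle_param b c \<phi>))"
      by (intro continuous_on_compose2[OF F] continuous_intros) auto
    have "integral {0..2 * pi} h = 2 * pi * F e - zonal_integral F e b c t"
      unfolding h_def zonal_integral_def s_eq[symmetric]
      by (subst integral_diff) (auto intro!: integrable_continuous_real c1)
    also have "\<dots> = 0"
      using zonal_integral_eq[of 0 F e b c t] F m even ebc t by (simp add: numeral_2_eq_2)
    finally have "\<forall>\<phi>\<in>{0..2 * pi}. h \<phi> = 0"
    proof (subst (asm) integral_eq_0_iff)
      show "continuous_on {0..2 * pi} h"
        unfolding h_def by (intro continuous_intros c1)
      have "norm (t *\<^sub>R e + s *\<^sub>R circle_param b c \<phi>) = 1" for \<phi>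
        using norm_latitude_point[OF ebc, of t s \<phi>] \<open>t\<^sup>2 + s\<^sup>2 = 1\<close>
        by (simp add: norm_eq_1 power2_norm_eq_inner)
      then show "h \<phi> \<ge> 0" for \<phi>
        by (simp add: h_def max)
    qed auto
    then have "h 0 = 0" by simp
    then show ?thesis
      by (simp add: h_def xeq circle_param_def)
  qed
  then show ?thesis by auto
qed

section \<open>Odd functions\<close>

text \<open>The mean value property for circles of arbitrary size: scaling by the distance of the circle
from the origin moves it onto the unit sphere.\<close>

lemma latitude_integral_homogeneous:
  fixes F :: "'a::euclidean_space \<Rightarrow> real"
  assumes F: "continuous_on UNIV F" and m: "mode_vanishes 3 F"
    and hom: "\<And>s x. F (s *\<^sub>R x) = s * F x" and ebc: "orthonormal_triple e b c" and "\<rho> \<ge> 0"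
  shows "integral {0..2 * pi} (\<lambda>\<phi>. F (\<alpha> *\<^sub>R e + \<rho> *\<^sub>R circle_param b c \<phi>)) = 2 * pi * \<alpha> * F e"
proof (cases "\<alpha>\<^sup>2 + \<rho>\<^sup>2 = 0")
  case True
  then show ?thesis
    using hom[of 0] by (simp add: sum_power2_eq_zero_iff)
next
  case False
  define n where "n = sqrt (\<alpha>\<^sup>2 + \<rho>\<^sup>2)"
  have n: "n > 0" "n\<^sup>2 = \<alpha>\<^sup>2 + \<rho>\<^sup>2"
    using False by (simp_all add: n_def sum_power2_gt_zero_iff sum_power2_eq_zero_iff)
  have "(\<alpha> / n)\<^sup>2 + (\<rho> / n)\<^sup>2 = 1" "\<rho> / n \<ge> 0"
    using False n \<open>\<rho> \<ge> 0\<close> by (simp_all add: power_divide flip: add_divide_distrib)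
  note \<rho> = unit_circle_upper(1)[OF this] and le = unit_circle_upper(2)[OF this]
  have "\<alpha> *\<^sub>R e + \<rho> *\<^sub>R circle_param b c \<phi>
      = n *\<^sub>R ((\<alpha> / n) *\<^sub>R e + sqrt (1 - (\<alpha> / n)\<^sup>2) *\<^sub>R circle_param b c \<phi>)" for \<phi>
    using n(1) by (simp add: scaleR_add_right flip: \<rho>)
  then have "integral {0..2 * pi} (\<lambda>\<phi>. F (\<alpha> *\<^sub>R e + \<rho> *\<^sub>R circle_param b c \<phi>))
      = n * zonal_integral F e b c (\<alpha> / n)"
    by (simp add: hom zonal_integral_def)
  also have "zonal_integral F e b c (\<alpha> / n) = 2 * pi * (\<alpha> / n) ^ 1 * F e"
    using hom[of "-1"] by (intro zonal_integral_eq F ebc le) (use m in \<open>auto simp: numeral_3_eq_3\<close>)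
  finally show ?thesis using n(1) by simp
qed

text \<open>The cube is not invariant under \<open>R\<close>, but the function lives in the unit ball, so the integral can be
taken over the whole space. Linear change of variables is formulated for functions with values in a
coordinate space, so \<open>g\<close> enters as a multiple of a fixed unit vector \<open>k\<close>.\<close>

lemma integral_orthogonal_transformation:
  fixes g :: "real ^ 3 \<Rightarrow> real" and R :: "real ^ 3 \<Rightarrow> real ^ 3"
  assumes R: "orthogonal_transformation R" and g: "continuous_on UNIV g"
    and zero: "\<And>x. norm x \<ge> 1 \<Longrightarrow> g x = 0"
  shows "integral (cbox (- One) One) (\<lambda>x. g (R x)) = integral (cbox (- One) One) g"
proof -
  have surj_R: "surj R"
    using R by (rule orthogonal_transformation_surj)
  have norm_R: "norm (R x) = norm x" for x
    using R by (simp add: orthogonal_transformation_norm)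
  have out: "norm x \<ge> 1" if "x \<notin> cbox (- One) One" for x :: "real ^ 3"
  proof -
    from that obtain i where "i \<in> Basis" "\<bar>x \<bullet> i\<bar> > 1"
      by (force simp: mem_box)
    then show ?thesis using Basis_le_norm[of i x] by linarith
  qed
  have UNIV_eq: "integral UNIV h = integral (cbox (- One) One) h"
    if "\<And>x. norm x \<ge> 1 \<Longrightarrow> h x = 0" for h :: "real ^ 3 \<Rightarrow> 'b::banach"
  proof -
    have "integral UNIV h = integral UNIV (\<lambda>x. if x \<in> cbox (- One) One then h x else 0)"
    proof (rule integral_cong)
      show "h x = (if x \<in> cbox (- One) One then h x else 0)" for x
        using out[of x] that[of x] by auto
    qed
    also have "\<dots> = integral (cbox (- One) One) h"
      by (rule Henstock_Kurzweil_Integration.integral_restrict_UNIV)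
    finally show ?thesis .
  qed
  define k :: "real ^ 3" where "k = axis 1 1"
  define f where "f = (\<lambda>x. g x *\<^sub>R k)"
  have "f absolutely_integrable_on cbox (- One) One"
    unfolding f_def
    by (intro absolutely_integrable_continuous continuous_intros continuous_on_subset[OF g]) auto
  then have "(\<lambda>x. if x \<in> cbox (- One) One then f x else 0) absolutely_integrable_on UNIV"
    by (simp add: absolutely_integrable_restrict_UNIV)
  also have "(\<lambda>x. if x \<in> cbox (- One) One then f x else 0) = f"
  proof
    show "(if x \<in> cbox (- One) One then f x else 0) = f x" for x
      using out[of x] zero[of x] by (auto simp: f_def)
  qed
  finally have "f absolutely_integrable_on R ` UNIV"
    by (simp add: surj_R)
  then have "integral (R ` UNIV) f = \<bar>det (matrix R)\<bar> *\<^sub>R integral UNIV (f \<circ> R)"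
    using R by (intro integral_change_of_variables_linear) (auto simp: orthogonal_transformation_linear)
  then have "integral UNIV f = integral UNIV (f \<circ> R)"
    using R by (simp add: surj_R orthogonal_transformation_det)
  moreover have scale: "integral (cbox (- One) One) (\<lambda>x. h x *\<^sub>R k) = integral (cbox (- One) One) h *\<^sub>R k"
    if "continuous_on UNIV h" for h :: "real ^ 3 \<Rightarrow> real"
    using integral_linear[OF integrable_continuous bounded_linear_scaleR_left, of "- One" One h k]
      continuous_on_subset[OF that] by (simp add: o_def)
  moreover have "integral UNIV f = integral (cbox (- One) One) g *\<^sub>R k"
    using zero by (subst UNIV_eq) (auto simp: f_def scale g)
  moreover have "continuous_on UNIV (\<lambda>x. g (R x))"
    using orthogonal_transformation_linear[OF R]
    by (intro continuous_on_compose2[OF g] linear_continuous_on)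
      (auto simp flip: linear_conv_bounded_linear)
  then have "integral UNIV (f \<circ> R) = integral (cbox (- One) One) (\<lambda>x. g (R x)) *\<^sub>R k"
    using zero norm_R by (subst UNIV_eq) (auto simp: f_def o_def scale)
  ultimately show ?thesis
    by (simp add: k_def)
qed

text \<open>The image of the standard frame under an orthogonal map that takes the first axis to \<open>e\<close>.\<close>

lemma orthonormal_triple_exists_R3:
  fixes e :: "real ^ 3"
  assumes "norm e = 1"
  obtains T :: "real ^ 3 \<Rightarrow> real ^ 3" and b c where "orthogonal_transformation T" "T (axis 1 1) = e" "orthonormal_triple e b c"
    "\<And>x. (norm x)\<^sup>2 = (x \<bullet> e)\<^sup>2 + (x \<bullet> b)\<^sup>2 + (x \<bullet> c)\<^sup>2"
proof -
  obtain T :: "real ^ 3 \<Rightarrow> real ^ 3" where T: "orthogonal_transformation T" "T (axis 1 1) = e"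
    using orthogonal_transformation_exists[of "axis 1 1" e] assms by auto
  have TT: "T x \<bullet> T y = x \<bullet> y" for x y
    using T(1) by (simp add: orthogonal_transformation_def)
  define b c where "b = T (axis 2 1)" and "c = T (axis 3 1)"
  have "orthonormal_triple e b c"
    by (simp add: orthonormal_triple_def b_def c_def norm_eq_1 TT inner_axis_axis flip: T(2))
  moreover have "(norm x)\<^sup>2 = (x \<bullet> e)\<^sup>2 + (x \<bullet> b)\<^sup>2 + (x \<bullet> c)\<^sup>2" for x
  proof -
    obtain y where y: "x = T y"
      using orthogonal_transformation_surj[OF T(1)] by (metis surjD)
    have "x \<bullet> e = y $ 1" "x \<bullet> b = y $ 2" "x \<bullet> c = y $ 3"
      by (simp_all add: y b_def c_def TT inner_axis flip: T(2))
    moreover have "(norm x)\<^sup>2 = y \<bullet> y"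
      unfolding y power2_norm_eq_inner by (simp add: TT)
    ultimately show ?thesis
      by (simp add: inner_vec_def sum_3 power2_eq_square)
  qed
  ultimately show ?thesis using that[OF T] by blast
qed

definition axis_rotation :: "'a::euclidean_space \<Rightarrow> 'a \<Rightarrow> 'a \<Rightarrow> real \<Rightarrow> 'a \<Rightarrow> 'a" where
  "axis_rotation e b c \<phi> x = (x \<bullet> e) *\<^sub>R e + (x \<bullet> b) *\<^sub>R circle_param b c \<phi>
     + (x \<bullet> c) *\<^sub>R circle_param b c (\<phi> + pi / 2)"

lemma axis_rotation_inner:
  assumes "orthonormal_triple e b c"
  shows "axis_rotation e b c \<phi> x \<bullet> e = x \<bullet> e"
  by (simp add: axis_rotation_def circle_param_def inner_simps orthonormal_triple_inner[OF assms])

lemma orthogonal_transformation_axis_rotation: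
  assumes ebc: "orthonormal_triple e b c"
    and norm: "\<And>x. (norm x)\<^sup>2 = (x \<bullet> e)\<^sup>2 + (x \<bullet> b)\<^sup>2 + (x \<bullet> c)\<^sup>2"
  shows "orthogonal_transformation (axis_rotation e b c \<phi>)"
proof -
  let ?R = "axis_rotation e b c \<phi>"
  note inn = orthonormal_triple_inner[OF ebc]
  have "linear ?R"
    by (rule linearI) (simp_all add: axis_rotation_def inner_add_left algebra_simps)
  moreover have "norm (?R x) = norm x" for x
  proof -
    have eq: "?R x = (x \<bullet> e) *\<^sub>R e + ((x \<bullet> b) * cos \<phi> - (x \<bullet> c) * sin \<phi>) *\<^sub>R b
        + ((x \<bullet> b) * sin \<phi> + (x \<bullet> c) * cos \<phi>) *\<^sub>R c"
      by (simp add: axis_rotation_def add.assoc circle_param_rotate)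
    have "(norm (?R x))\<^sup>2 = (x \<bullet> e)\<^sup>2 + ((x \<bullet> b) * cos \<phi> - (x \<bullet> c) * sin \<phi>)\<^sup>2
        + ((x \<bullet> b) * sin \<phi> + (x \<bullet> c) * cos \<phi>)\<^sup>2"
      by (subst norm) (simp add: eq inner_simps inn)
    also have "\<dots> = (x \<bullet> e)\<^sup>2 + (x \<bullet> b)\<^sup>2 * ((sin \<phi>)\<^sup>2 + (cos \<phi>)\<^sup>2) + (x \<bullet> c)\<^sup>2 * ((sin \<phi>)\<^sup>2 + (cos \<phi>)\<^sup>2)"
      by algebra
    also have "\<dots> = (norm x)\<^sup>2"
      by (simp add: norm)
    finally show ?thesis by simp
  qed
  ultimately show ?thesis
    by (simp add: orthogonal_transformation)
qed

text \<open>Let \<open>J\<close> be the integral of the vector field \<open>\<eta> x * H x *\<^sub>R x\<close> with the radial weight \<open>\<eta>\<close>. Averaging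
over the rotations about \<open>e\<close> turns \<open>J \<bullet> e\<close> into \<open>H e\<close> times the integral of \<open>\<eta> x * (x \<bullet> e)\<^sup>2\<close>,
which is positive and, by invariance, the same for all unit vectors \<open>e\<close>. So \<open>H\<close> is the inner product with a
multiple of \<open>J\<close>.\<close>

proposition homogeneous_mode_three_imp_linear_R3:
  fixes H :: "real ^ 3 \<Rightarrow> real"
  assumes H: "continuous_on UNIV H" and m: "mode_vanishes 3 H" and hom: "\<And>s x. H (s *\<^sub>R x) = s * H x"
  shows "\<exists>a. \<forall>x. H x = a \<bullet> x"
proof -
  define Q :: "(real ^ 3) set" where "Q = cbox (- One) One"
  define \<eta> where "\<eta> = (\<lambda>x::real ^ 3. max 0 (1 - norm x))"
  have \<eta>: "continuous_on A \<eta>" "\<eta> x \<ge> 0" "norm x \<ge> 1 \<Longrightarrow> \<eta> x = 0" for A x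
    unfolding \<eta>_def by (auto intro!: continuous_intros)
  have Hc: "continuous_on A H" for A
    using H continuous_on_subset by blast
  define J where "J = integral Q (\<lambda>x. (\<eta> x * H x) *\<^sub>R x)"
  define C where "C = (\<lambda>e. integral Q (\<lambda>x. \<eta> x * (x \<bullet> e)\<^sup>2))"
  have J: "J \<bullet> e = integral Q (\<lambda>x. \<eta> x * H x * (x \<bullet> e))" for e
  proof -
    have "(\<lambda>x. (\<eta> x * H x) *\<^sub>R x) integrable_on Q"
      unfolding Q_def by (intro integrable_continuous continuous_intros \<eta> Hc)
    from integral_linear[OF this bounded_linear_inner_left[of e]] show ?thesis
      by (simp add: J_def o_def)
  qed
  have inv: "integral Q (\<lambda>x. g (R x)) = integral Q g"
    if "orthogonal_transformation R" "continuous_on UNIV g" "\<And>x. norm x \<ge> 1 \<Longrightarrow> g x = 0"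
    for R :: "real ^ 3 \<Rightarrow> real ^ 3" and g :: "real ^ 3 \<Rightarrow> real"
    unfolding Q_def by (rule integral_orthogonal_transformation[OF that])
  have key: "J \<bullet> e = C (axis 1 1) * H e" if e: "norm e = 1" for e
  proof -
    obtain T :: "real ^ 3 \<Rightarrow> real ^ 3" and b c where T: "orthogonal_transformation T" "T (axis 1 1) = e"
      and ebc: "orthonormal_triple e b c"
      and norm: "\<And>x. (norm x)\<^sup>2 = (x \<bullet> e)\<^sup>2 + (x \<bullet> b)\<^sup>2 + (x \<bullet> c)\<^sup>2"
      using orthonormal_triple_exists_R3[OF e] by metis
    have C_eq: "C e = C (axis 1 1)"
    proof -
      have "C e = integral Q (\<lambda>x. \<eta> (T x) * (T x \<bullet> e)\<^sup>2)"
        unfolding C_def by (rule inv[symmetric, OF T(1)]) (auto intro!: continuous_intros \<eta> simp: \<eta>)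
      also have "(\<lambda>x. \<eta> (T x) * (T x \<bullet> e)\<^sup>2) = (\<lambda>x. \<eta> x * (x \<bullet> axis 1 1)\<^sup>2)"
        using T(1) by (simp add: \<eta>_def orthogonal_transformation_norm orthogonal_transformation_def flip: T(2))
      finally show ?thesis by (simp add: C_def)
    qed
    define R where "R = axis_rotation e b c"
    have R: "orthogonal_transformation (R \<phi>)" for \<phi>
      unfolding R_def by (rule orthogonal_transformation_axis_rotation[OF ebc norm])
    have R\<eta>: "\<eta> (R \<phi> x) = \<eta> x" for \<phi> x
      using R by (simp add: \<eta>_def orthogonal_transformation_norm)
    have Re: "R \<phi> x \<bullet> e = x \<bullet> e" for \<phi> x
      unfolding R_def by (rule axis_rotation_inner[OF ebc])
    have avg: "integral {0..2 * pi} (\<lambda>\<phi>. H (R \<phi> x)) = 2 * pi * (x \<bullet> e) * H e" for x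
      unfolding R_def axis_rotation_def integral_circle_rotate[OF H]
      by (rule latitude_integral_homogeneous[OF H m hom ebc]) simp
    have cont: "continuous_on (cbox (0, - One) (2 * pi, One)) (\<lambda>(\<phi>, x). \<eta> x * H (R \<phi> x) * (x \<bullet> e))"
      unfolding case_prod_unfold R_def axis_rotation_def
      by (intro continuous_intros continuous_on_compose2[OF H] continuous_on_compose2[OF \<eta>(1)[of UNIV]]) auto
    have "2 * pi * (J \<bullet> e) = integral {0..2 * pi} (\<lambda>\<phi>. integral Q (\<lambda>x. \<eta> (R \<phi> x) * H (R \<phi> x) * (R \<phi> x \<bullet> e)))"
      unfolding J
      by (subst inv[OF R]) (auto intro!: continuous_intros \<eta> Hc simp: \<eta>)
    also have "\<dots> = integral {0..2 * pi} (\<lambda>\<phi>. integral Q (\<lambda>x. \<eta> x * H (R \<phi> x) * (x \<bullet> e)))"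
      by (simp add: R\<eta> Re)
    also have "\<dots> = integral Q (\<lambda>x. integral {0..2 * pi} (\<lambda>\<phi>. \<eta> x * H (R \<phi> x) * (x \<bullet> e)))"
      using integral_swap_continuous[OF cont] by (simp add: Q_def)
    also have "\<dots> = integral Q (\<lambda>x. 2 * pi * H e * (\<eta> x * (x \<bullet> e)\<^sup>2))"
    proof (rule integral_cong)
      show "integral {0..2 * pi} (\<lambda>\<phi>. \<eta> x * H (R \<phi> x) * (x \<bullet> e)) = 2 * pi * H e * (\<eta> x * (x \<bullet> e)\<^sup>2)" for x
        by (simp add: avg power2_eq_square)
    qed
    also have "\<dots> = 2 * pi * H e * C e"
      by (simp add: C_def)
    finally show ?thesis by (simp add: C_eq)
  qed
  have "C (axis 1 1) \<noteq> 0"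
  proof
    assume "C (axis 1 1) = 0"
  \<comment> \<open>A point of the open unit ball off the plane orthogonal to the first axis, where the integrand is positive.\<close>
    define z :: "real ^ 3" where "z = (1 / 2) *\<^sub>R axis 1 1"
    have "\<forall>x\<in>Q. \<eta> x * (x \<bullet> axis 1 1)\<^sup>2 = 0"
      using \<open>C (axis 1 1) = 0\<close> unfolding C_def Q_def
    proof (subst (asm) integral_cbox_eq_0_iff)
      show "box (- One) One \<noteq> ({} :: (real ^ 3) set)"
        by (auto simp: box_ne_empty)
    qed (auto intro!: continuous_intros mult_nonneg_nonneg \<eta>)
    moreover have "z \<in> Q"
    proof -
      have "\<bar>z \<bullet> i\<bar> \<le> 1" if "i \<in> Basis" for i
        using Basis_le_norm[OF that, of z] by (simp add: z_def)
      then show ?thesis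
        by (auto simp: Q_def mem_box abs_le_iff)
    qed
    ultimately have "\<eta> z * (z \<bullet> axis 1 1)\<^sup>2 = 0" by blast
    then show False
      by (simp add: z_def \<eta>_def inner_axis_axis)
  qed
  have "H x = (J /\<^sub>R C (axis 1 1)) \<bullet> x" for x
  proof (cases "x = 0")
    case True
    then show ?thesis using hom[of 0 0] by simp
  next
    case False
    then have "H x = norm x * H (sgn x)"
      by (simp add: sgn_div_norm flip: hom)
    also have "H (sgn x) = (J \<bullet> sgn x) / C (axis 1 1)"
      using key[of "sgn x"] \<open>C (axis 1 1) \<noteq> 0\<close> False by (simp add: norm_sgn)
    finally show ?thesis
      using False by (simp add: sgn_div_norm field_simps)
  qed
  then show ?thesis by blast
qed

text \<open>Two vectors \<open>x\<close> and \<open>y\<close> lie in the image of an isometric embedding \<open>L\<close> of \<open>\<real>\<^sup>3\<close>, and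
\<open>F \<circ> L\<close> is the inner product with a vector.\<close>

proposition homogeneous_mode_three_imp_linear:
  fixes F :: "'a::euclidean_space \<Rightarrow> real"
  assumes dim: "DIM('a) \<ge> 3" and F: "continuous_on UNIV F" and m: "mode_vanishes 3 F"
    and hom: "\<And>s x. F (s *\<^sub>R x) = s * F x"
  shows "linear F"
proof (rule linearI)
  fix x y
  have F0: "F 0 = 0" using hom[of 0 0] by simp
  show "F (x + y) = F x + F y"
  proof (cases "x = 0")
    case False
    define e where "e = sgn x"
    have e: "norm e = 1" and xe: "x = norm x *\<^sub>R e"
      using False by (simp_all add: e_def norm_sgn sgn_div_norm)
    have "DIM('a) \<ge> 2" using dim by simp
    then obtain b s where b: "norm b = 1" "e \<bullet> b = 0" and yb: "y = (y \<bullet> e) *\<^sub>R e + s *\<^sub>R b"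
      using orthogonal_decomposition[OF e _, of y] by blast
    obtain c where ebc: "orthonormal_triple e b c"
      using orthonormal_triple_extend[OF dim e b] .
    note inn = orthonormal_triple_inner[OF ebc]
    define L :: "real ^ 3 \<Rightarrow> 'a" where "L = (\<lambda>v. v $ 1 *\<^sub>R e + v $ 2 *\<^sub>R b + v $ 3 *\<^sub>R c)"
    have L_add: "L (u + v) = L u + L v" and L_scale: "L (r *\<^sub>R v) = r *\<^sub>R L v" for u v r
      by (simp_all add: L_def algebra_simps)
    have L_inner: "L u \<bullet> L v = u \<bullet> v" for u v
      by (simp add: L_def inner_simps inn inner_vec_def sum_3)
    have "\<exists>a. \<forall>v. F (L v) = a \<bullet> v"
    proof (rule homogeneous_mode_three_imp_linear_R3)
      show "continuous_on UNIV (\<lambda>v. F (L v))"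
        unfolding L_def by (intro continuous_on_compose2[OF F] continuous_intros) auto
      have "L (circle_param u v \<theta>) = circle_param (L u) (L v) \<theta>" for u v \<theta>
        by (simp add: circle_param_def L_add L_scale)
      then show "mode_vanishes 3 (\<lambda>v. F (L v))"
        using m by (simp add: mode_vanishes_def norm_eq_1 L_inner)
    qed (simp add: L_scale hom)
    then obtain a where a: "\<And>v. F (L v) = a \<bullet> v" by blast
    have "x = L (vector [norm x, 0, 0])" "y = L (vector [y \<bullet> e, s, 0])"
      using xe yb by (simp_all add: L_def)
    then show ?thesis
      by (metis a L_add inner_add_right)
  qed (simp add: F0)
qed (simp add: hom)

section \<open>Functions on the sphere\<close>

text \<open>The extension of degree one of a function on the sphere. It is continuous at the origin for every continuous \<open>g\<close>,
and it is homogeneous with respect to negative factors too when \<open>g\<close> is odd.\<close>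

definition homogeneous_ext :: "('a::euclidean_space \<Rightarrow> real) \<Rightarrow> 'a \<Rightarrow> real" where
  "homogeneous_ext g x = norm x * g (sgn x)"

lemma homogeneous_ext_sphere: "norm x = 1 \<Longrightarrow> homogeneous_ext g x = g x"
  by (simp add: homogeneous_ext_def sgn_div_norm)

lemma continuous_on_homogeneous_ext:
  fixes g :: "'a::euclidean_space \<Rightarrow> real"
  assumes g: "continuous_on (sphere 0 1) g"
  shows "continuous_on UNIV (homogeneous_ext g)"
proof -
  have "isCont (homogeneous_ext g) x" for x
  proof (cases "x = 0")
    case True
    have "bounded (g ` sphere 0 1)"
      using g compact_continuous_image compact_imp_bounded compact_sphere by blast
    then obtain B where B: "\<And>y. norm y = 1 \<Longrightarrow> \<bar>g y\<bar> \<le> B"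
      by (force simp: bounded_iff)
    have "((\<lambda>y::'a. norm y * B) \<longlongrightarrow> norm (0::'a) * B) (at 0)"
      by (intro tendsto_intros)
    moreover have "norm (homogeneous_ext g y) \<le> norm y * B" if "y \<noteq> 0" for y
      using B[of "sgn y"] that by (simp add: homogeneous_ext_def abs_mult norm_sgn mult_left_mono)
    then have "\<forall>\<^sub>F y in at 0. norm (homogeneous_ext g y) \<le> norm y * B"
      by (rule eventually_mono[OF eventually_neq_at_within[of 0]])
    ultimately have "(homogeneous_ext g \<longlongrightarrow> 0) (at 0)"
      by (intro Lim_null_comparison[of "homogeneous_ext g" "\<lambda>y. norm y * B"]) simp_all
    then show ?thesis
      using True by (simp add: isCont_def homogeneous_ext_def)
  next
    case False
    have "continuous_on (- {0}) (\<lambda>x. norm x * g (sgn x))"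
      by (intro continuous_intros continuous_on_compose2[OF g]) (auto simp: norm_sgn split: if_splits)
    then have "continuous_on (- {0}) (homogeneous_ext g)"
      by (simp add: homogeneous_ext_def[abs_def])
    then show ?thesis
      using False by (simp add: continuous_on_eq_continuous_at open_Compl)
  qed
  then show ?thesis
    by (simp add: continuous_on_eq_continuous_at)
qed

lemma mode_vanishes_cong:
  assumes "\<And>x. norm x = 1 \<Longrightarrow> F x = G x"
  shows "mode_vanishes m F \<longleftrightarrow> mode_vanishes m G"
  using assms by (simp add: mode_vanishes_def norm_circle_param)

lemma mode_vanishes_of_fourier_pair:
  fixes f :: "'a::euclidean_space \<Rightarrow> real"
  assumes f: "continuous_on (sphere 0 1) f"
    and van: "\<And>C. great_circle C \<Longrightarrow> fourier_pair_vanishes f C (int m)"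
  shows "mode_vanishes m f"
  unfolding mode_vanishes_def
proof (intro allI impI)
  fix u v :: 'a assume uv: "norm u = 1" "norm v = 1" "u \<bullet> v = 0"
  define C where "C = sphere 0 1 \<inter> span {u, v}"
  have "circle_frame C u v"
    using uv by (simp add: circle_frame_def C_def)
  then have zero: "circle_fourier f u v (int m) = 0"
    using van[of C] great_circle_iff by (auto simp: fourier_pair_vanishes_def)
  define h where "h = (\<lambda>\<theta>. complex_of_real (f (circle_param u v \<theta>)) * exp (- \<i> * of_int (int m) * of_real \<theta>))"
  have "continuous_on {0..2 * pi} h"
    unfolding h_def
    by (intro continuous_intros continuous_on_compose2[OF f]) (auto simp: norm_circle_param uv)
  then have "h integrable_on {0..2 * pi}"
    by (rule integrable_continuous_real)
  from integral_linear[OF this bounded_linear_Re]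
  have "integral {0..2 * pi} (\<lambda>\<theta>. Re (h \<theta>)) = Re (integral {0..2 * pi} h)"
    by (simp add: o_def)
  also have "\<dots> = 0"
    using zero by (simp add: circle_fourier_def h_def)
  also have "(\<lambda>\<theta>::real. Re (h \<theta>)) = (\<lambda>\<theta>. f (circle_param u v \<theta>) * cos (real m * \<theta>))"
    by (simp add: h_def Re_exp)
  finally show "integral {0..2 * pi} (\<lambda>\<theta>. f (circle_param u v \<theta>) * cos (m * \<theta>)) = 0" .
qed

lemma mode_vanishes_reflect:
  fixes f :: "'a::euclidean_space \<Rightarrow> real"
  assumes "mode_vanishes m f"
  shows "mode_vanishes m (\<lambda>x. f (- x))"
proof -
  have "- circle_param u v \<theta> = circle_param (- u) (- v) \<theta>" for u v :: 'a and \<theta>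
    by (simp add: circle_param_def)
  then show ?thesis
    using assms by (simp add: mode_vanishes_def)
qed

lemma mode_vanishes_linear_combination:
  fixes f g :: "'a::euclidean_space \<Rightarrow> real"
  assumes f: "continuous_on (sphere 0 1) f" "mode_vanishes m f"
    and g: "continuous_on (sphere 0 1) g" "mode_vanishes m g"
  shows "mode_vanishes m (\<lambda>x. \<alpha> * f x + \<beta> * g x)"
  unfolding mode_vanishes_def
proof (intro allI impI)
  fix u v :: 'a assume uv: "norm u = 1" "norm v = 1" "u \<bullet> v = 0"
  have int: "(\<lambda>\<theta>. h (circle_param u v \<theta>) * cos (m * \<theta>)) integrable_on {0..2 * pi}"
    if "continuous_on (sphere 0 1) h" for h
    by (intro integrable_continuous_real continuous_intros continuous_on_compose2[OF that])
      (auto simp: norm_circle_param uv)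
  have "integral {0..2 * pi} (\<lambda>\<theta>. \<alpha> * (f (circle_param u v \<theta>) * cos (m * \<theta>))
      + \<beta> * (g (circle_param u v \<theta>) * cos (m * \<theta>))) = 0"
    using f(2) g(2) uv
    by (subst integral_add) (auto simp: mode_vanishes_def intro!: integrable_on_mult_right int f g)
  then show "integral {0..2 * pi} (\<lambda>\<theta>. (\<alpha> * f (circle_param u v \<theta>) + \<beta> * g (circle_param u v \<theta>)) * cos (m * \<theta>)) = 0"
    by (simp add: algebra_simps)
qed

theorem theorem1p4:
  fixes f :: "real ^ 'n \<Rightarrow> real"
  assumes "CARD('n) \<ge> 3"
    and "continuous_on (sphere 0 1) f"
    and "\<And>C j. great_circle C \<Longrightarrow> j \<in> {2, 3} \<Longrightarrow> fourier_pair_vanishes f C j"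
  shows "\<exists>(c::real) (a::real ^ 'n). \<forall>x\<in>sphere 0 1. f x = c + a \<bullet> x"
proof -
  note f = assms(2)
  have dim: "DIM(real ^ 'n) \<ge> 3"
    using assms(1) by simp
  have f': "continuous_on (sphere 0 1) (\<lambda>x. f (- x))"
    by (intro continuous_on_compose2[OF f] continuous_intros) auto
  define p where "p = (\<lambda>x. 1 / 2 * f x + 1 / 2 * f (- x))"
  define q where "q = (\<lambda>x. 1 / 2 * f x + (- 1 / 2) * f (- x))"
  have cont: "continuous_on (sphere 0 1) p" "continuous_on (sphere 0 1) q"
    unfolding p_def q_def by (intro continuous_intros f f')+
  have f23: "mode_vanishes 2 f" "mode_vanishes 3 f"
    using assms(3) by (auto intro!: mode_vanishes_of_fourier_pair f)
  have "mode_vanishes 2 p" "mode_vanishes 3 q"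
    unfolding p_def q_def
    by (intro mode_vanishes_linear_combination mode_vanishes_reflect f23 f f')+
  then have modes: "mode_vanishes 2 (homogeneous_ext p)" "mode_vanishes 3 (homogeneous_ext q)"
    by (simp_all add: homogeneous_ext_sphere cong: mode_vanishes_cong)
  have "homogeneous_ext p (- x) = homogeneous_ext p x" for x
    by (simp add: homogeneous_ext_def sgn_minus p_def)
  then obtain c where c: "\<And>x. norm x = 1 \<Longrightarrow> homogeneous_ext p x = c"
    using even_mode_two_imp_constant[OF dim continuous_on_homogeneous_ext[OF cont(1)] modes(1)] by auto
  have "homogeneous_ext q (s *\<^sub>R x) = s * homogeneous_ext q x" for s x
    by (cases s "0::real" rule: linorder_cases)
       (auto simp: homogeneous_ext_def sgn_scaleR q_def algebra_simps)
  then have "linear (homogeneous_ext q)"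
    by (rule homogeneous_mode_three_imp_linear[OF dim continuous_on_homogeneous_ext[OF cont(2)] modes(2)])
  then have lin: "homogeneous_ext q x = adjoint (homogeneous_ext q) 1 \<bullet> x" for x
    using adjoint_works[of "homogeneous_ext q" x 1] by (simp add: inner_commute)
  have "f x = c + adjoint (homogeneous_ext q) 1 \<bullet> x" if "x \<in> sphere 0 1" for x
  proof -
    have "f x = p x + q x"
      by (simp add: p_def q_def)
    then show ?thesis
      using that c[of x] lin[of x] by (simp add: homogeneous_ext_sphere)
  qed
  then show ?thesis by blast
qed

end
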